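(* Let $b$ be a connected, locally finite combinatorial graph over $(X,m)$ with $m\equiv1$, i.e. $b$ takes only the values $0$ and $1$ and $m(x)=1$ for all $x\in X$. Suppose that the graph satisfies $CD(K,\infty)$ for some $K>0$ and is stochastically complete. Then the graph is finite, i.e. $X$ is a finite set.
   Context: $X$ is a countable discrete set and $m:X\to(0,\infty)$, extended to a measure by additivity. A locally finite graph over $(X,m)$ is a symmetric function $b:X\times X\to[0,\infty)$ with zero diagonal such that $\{y\in X: b(x,y)>0\}$ is finite for every $x\in X$. It is connected if any two vertices $x,y\in X$ are joined by a path $x=x_0,x_1,\dots,x_N=y$ with $b(x_{i-1},x_i)>0$ for $i=1,\dots,N$. $C(X)$ denotes all real-valued functions on $X$ and $C_c(X)$ the finitely supported ones. The Laplacian on $C(X)$ is $\Delta f(x)=\frac{1}{m(x)}\sum_{y\in X}b(x,y)(f(y)-f(x))$. Set $\Gamma_0(f,g)=fg$ and iteratively $2\Gamma_{k+1}(f,g)=\Delta\Gamma_k(f,g)-\Gamma_k(f,\Delta g)-\Gamma_k(\Delta f,g)$ for $f,g\in C(X)$, $k\ge 0$; write $\Gamma_k(f)=\Gamma_k(f,f)$ and $\Gamma=\Gamma_1$. The graph satisfies $CD(K,\infty)$, $K\in\mathbb{R}$, if $\Gamma_2(f)\ge K\,\Gamma(f)$ pointwise on $X$ for all $f\in C(X)$. $L$ denotes the Friedrichs extension in $\ell^2(X,m)$ of the symmetric positive operator $-\Delta|_{C_c(X)}$, and $P_t=e^{-tL}$, $t\ge0$, is the heat semigroup. It extends to a positive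 contraction semigroup on every $\ell^p(X,m)$, $p\in[1,\infty]$, given by $P_tf(x)=\sum_{y\in X}p_t(x,y)f(y)m(y)$ with $p_t(x,y)=(P_t1_y)(x)/m(y)$, where $1_y$ is the characteristic function of $\{y\}$. The graph is stochastically complete if $P_t1=1$ for all $t\ge0$, where $1$ is the constant function. *)

theory Defs
  imports "HOL-Analysis.Analysis" "HOL-Library.Countable"
begin

text \<open>The vertex set is the whole (countable) type \<open>'a\<close>.\<close>

definition locally_finite_graph :: "('a \<Rightarrow> 'a \<Rightarrow> real) \<Rightarrow> ('a \<Rightarrow> real) \<Rightarrow> bool" where
  "locally_finite_graph b m \<longleftrightarrow>
     (\<forall>x. 0 < m x) \<and> (\<forall>x y. 0 \<le> b x y) \<and> (\<forall>x y. b x y = b y x) \<and> (\<forall>x. b x x = 0) \<and>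
     (\<forall>x. finite {y. 0 < b x y})"

definition connected_graph :: "('a \<Rightarrow> 'a \<Rightarrow> real) \<Rightarrow> bool" where
  "connected_graph b \<longleftrightarrow> (\<forall>x y. (\<lambda>u v. 0 < b u v)\<^sup>*\<^sup>* x y)"

definition laplacian :: "('a \<Rightarrow> 'a \<Rightarrow> real) \<Rightarrow> ('a \<Rightarrow> real) \<Rightarrow> ('a \<Rightarrow> real) \<Rightarrow> 'a \<Rightarrow> real" where
  "laplacian b m f x = 1 / m x * (\<Sum>y | 0 < b x y. b x y * (f y - f x))"

primrec Gamma_op ::
  "('a \<Rightarrow> 'a \<Rightarrow> real) \<Rightarrow> ('a \<Rightarrow> real) \<Rightarrow> nat \<Rightarrow> ('a \<Rightarrow> real) \<Rightarrow> ('a \<Rightarrow> real) \<Rightarrow> 'a \<Rightarrow> real" where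
  "Gamma_op b m 0 = (\<lambda>f g x. f x * g x)"
| "Gamma_op b m (Suc k) = (\<lambda>f g x.
     (laplacian b m (Gamma_op b m k f g) x
      - Gamma_op b m k f (laplacian b m g) x
      - Gamma_op b m k (laplacian b m f) g x) / 2)"

definition CD_infinity :: "('a \<Rightarrow> 'a \<Rightarrow> real) \<Rightarrow> ('a \<Rightarrow> real) \<Rightarrow> real \<Rightarrow> bool" where
  "CD_infinity b m K \<longleftrightarrow> (\<forall>f x. Gamma_op b m 2 f f x \<ge> K * Gamma_op b m 1 f f x)"

definition fin_supp :: "('a \<Rightarrow> real) set" where
  "fin_supp = {f. finite {x. f x \<noteq> 0}}"

definition ell2 :: "('a \<Rightarrow> real) \<Rightarrow> ('a \<Rightarrow> real) set" where
  "ell2 m = {f. (\<lambda>x. (f x)\<^sup>2 * m x) summable_on UNIV}"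

definition ell2_inner :: "('a \<Rightarrow> real) \<Rightarrow> ('a \<Rightarrow> real) \<Rightarrow> ('a \<Rightarrow> real) \<Rightarrow> real" where
  "ell2_inner m f g = (\<Sum>\<^sub>\<infinity>x. f x * g x * m x)"

definition ell2_norm :: "('a \<Rightarrow> real) \<Rightarrow> ('a \<Rightarrow> real) \<Rightarrow> real" where
  "ell2_norm m f = sqrt (ell2_inner m f f)"

text \<open>
  The form of the symmetric positive operator \<open>-\<Delta>\<close> on the finitely supported functions,
  its closure in \<open>\<ell>\<^sup>2\<close>, and the self-adjoint operator associated with the closure.
\<close>

definition pre_form :: "('a \<Rightarrow> 'a \<Rightarrow> real) \<Rightarrow> ('a \<Rightarrow> real) \<Rightarrow> ('a \<Rightarrow> real) \<Rightarrow> ('a \<Rightarrow> real) \<Rightarrow> real" where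
  "pre_form b m f g = ell2_inner m (\<lambda>x. - laplacian b m f x) g"

definition form_approx ::
  "('a \<Rightarrow> 'a \<Rightarrow> real) \<Rightarrow> ('a \<Rightarrow> real) \<Rightarrow> (nat \<Rightarrow> 'a \<Rightarrow> real) \<Rightarrow> ('a \<Rightarrow> real) \<Rightarrow> bool" where
  "form_approx b m \<phi> u \<longleftrightarrow>
     (\<forall>n. \<phi> n \<in> fin_supp) \<and> u \<in> ell2 m \<and>
     (\<lambda>n. ell2_norm m (\<lambda>x. \<phi> n x - u x)) \<longlonglongrightarrow> 0 \<and>
     (\<forall>e>0. \<exists>N. \<forall>i\<ge>N. \<forall>j\<ge>N.
        pre_form b m (\<lambda>x. \<phi> i x - \<phi> j x) (\<lambda>x. \<phi> i x - \<phi> j x) < e)"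

definition form_domain :: "('a \<Rightarrow> 'a \<Rightarrow> real) \<Rightarrow> ('a \<Rightarrow> real) \<Rightarrow> ('a \<Rightarrow> real) set" where
  "form_domain b m = {u. \<exists>\<phi>. form_approx b m \<phi> u}"

text \<open>Well defined on the form domain, since the form of a symmetric positive operator is closable.\<close>

definition closed_form ::
  "('a \<Rightarrow> 'a \<Rightarrow> real) \<Rightarrow> ('a \<Rightarrow> real) \<Rightarrow> ('a \<Rightarrow> real) \<Rightarrow> ('a \<Rightarrow> real) \<Rightarrow> real" where
  "closed_form b m u v =
     (THE c. \<forall>\<phi> \<psi>. form_approx b m \<phi> u \<longrightarrow> form_approx b m \<psi> v \<longrightarrow>
        (\<lambda>n. pre_form b m (\<phi> n) (\<psi> n)) \<longlonglongrightarrow> c)"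

text \<open>
  The graph of the unbounded operator \<open>L\<close>: \<open>friedrichs b m u h\<close> means
  \<open>u \<in> D(L)\<close> and \<open>L u = h\<close>.
\<close>

definition friedrichs ::
  "('a \<Rightarrow> 'a \<Rightarrow> real) \<Rightarrow> ('a \<Rightarrow> real) \<Rightarrow> ('a \<Rightarrow> real) \<Rightarrow> ('a \<Rightarrow> real) \<Rightarrow> bool" where
  "friedrichs b m u h \<longleftrightarrow>
     u \<in> form_domain b m \<and> h \<in> ell2 m \<and>
     (\<forall>v \<in> form_domain b m. closed_form b m u v = ell2_inner m h v)"

definition C0_semigroup :: "('a \<Rightarrow> real) \<Rightarrow> (real \<Rightarrow> ('a \<Rightarrow> real) \<Rightarrow> 'a \<Rightarrow> real) \<Rightarrow> bool" where
  "C0_semigroup m P \<longleftrightarrow>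
     (\<forall>t\<ge>0. \<forall>f\<in>ell2 m. P t f \<in> ell2 m) \<and>
     (\<forall>t\<ge>0. \<forall>f\<in>ell2 m. \<forall>g\<in>ell2 m. \<forall>\<alpha> \<beta>.
        P t (\<lambda>x. \<alpha> * f x + \<beta> * g x) = (\<lambda>x. \<alpha> * P t f x + \<beta> * P t g x)) \<and>
     (\<forall>t\<ge>0. \<exists>C. \<forall>f\<in>ell2 m. ell2_norm m (P t f) \<le> C * ell2_norm m f) \<and>
     (\<forall>f\<in>ell2 m. P 0 f = f) \<and>
     (\<forall>s\<ge>0. \<forall>t\<ge>0. \<forall>f\<in>ell2 m. P (s + t) f = P s (P t f)) \<and>
     (\<forall>f\<in>ell2 m. ((\<lambda>t. ell2_norm m (\<lambda>x. P t f x - f x)) \<longlongrightarrow> 0) (at_right 0))"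

definition generator ::
  "('a \<Rightarrow> real) \<Rightarrow> (real \<Rightarrow> ('a \<Rightarrow> real) \<Rightarrow> 'a \<Rightarrow> real) \<Rightarrow> ('a \<Rightarrow> real) \<Rightarrow> ('a \<Rightarrow> real) \<Rightarrow> bool" where
  "generator m P u g \<longleftrightarrow>
     u \<in> ell2 m \<and> g \<in> ell2 m \<and>
     ((\<lambda>t. ell2_norm m (\<lambda>x. (P t u x - u x) / t - g x)) \<longlongrightarrow> 0) (at_right 0)"

text \<open>
  \<open>P t = exp (-t L)\<close>: the strongly continuous semigroup generated by \<open>-L\<close>.  On \<open>\<ell>\<^sup>2\<close> and for
  \<open>t \<ge> 0\<close> it exists and is unique because \<open>L\<close> is self-adjoint and nonnegative; other values
  of \<open>P\<close> are unconstrained and never used.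
\<close>

definition heat_semigroup ::
  "('a \<Rightarrow> 'a \<Rightarrow> real) \<Rightarrow> ('a \<Rightarrow> real) \<Rightarrow> (real \<Rightarrow> ('a \<Rightarrow> real) \<Rightarrow> 'a \<Rightarrow> real) \<Rightarrow> bool" where
  "heat_semigroup b m P \<longleftrightarrow>
     C0_semigroup m P \<and> (\<forall>u h. generator m P u (\<lambda>x. - h x) \<longleftrightarrow> friedrichs b m u h)"

definition heat_kernel ::
  "('a \<Rightarrow> real) \<Rightarrow> (real \<Rightarrow> ('a \<Rightarrow> real) \<Rightarrow> 'a \<Rightarrow> real) \<Rightarrow> real \<Rightarrow> 'a \<Rightarrow> 'a \<Rightarrow> real" where
  "heat_kernel m P t x y = P t (indicator {y}) x / m y"

definition heat_extension ::
  "('a \<Rightarrow> real) \<Rightarrow> (real \<Rightarrow> ('a \<Rightarrow> real) \<Rightarrow> 'a \<Rightarrow> real) \<Rightarrow> real \<Rightarrow> ('a \<Rightarrow> real) \<Rightarrow> 'a \<Rightarrow> real" where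
  "heat_extension m P t f x = (\<Sum>\<^sub>\<infinity>y. heat_kernel m P t x y * f y * m y)"

definition stochastically_complete :: "('a \<Rightarrow> 'a \<Rightarrow> real) \<Rightarrow> ('a \<Rightarrow> real) \<Rightarrow> bool" where
  "stochastically_complete b m \<longleftrightarrow>
     (\<exists>P. heat_semigroup b m P \<and> (\<forall>t\<ge>0. heat_extension m P t (\<lambda>_. 1) = (\<lambda>_. 1)))"

end

theory Submission
  imports Defs
begin

text \<open>
  Let \<open>u\<close> be the heat flow started at a finitely supported function with \<open>\<bar>u\<bar> \<le> 1\<close>, and let
  \<open>a\<close> solve \<open>a' = 2 K a + 2\<close>, \<open>a(0) = 0\<close>.  By \<open>CD(K,\<infinity>)\<close> the function \<open>F = a \<Gamma>(u) + u\<^sup>2\<close> is a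
  subsolution of the heat equation.  The energy of \<open>u\<close> is finite and \<open>m = 1\<close>, so \<open>F\<close> vanishes at
  infinity, locally uniformly in time, and the elementary maximum principle yields
  \<open>\<Gamma>(u\<^sub>t) \<le> K / (exp (2 K t) - 1)\<close>.  Hence \<open>\<bar>\<Delta> u\<^sub>t(x)\<bar> \<le> C\<^sub>x exp (- K t)\<close> with \<open>C\<^sub>x\<close> independent of the
  initial function.  On an infinite graph \<open>u\<^sub>t(x) \<rightarrow> 0\<close>, because a constant in \<open>\<ell>\<^sup>2\<close> vanishes, so
  integrating in time gives \<open>u\<^sub>t(x) \<le> C\<^sub>x exp (- K t) / K\<close>.  Starting from indicators of finite
  sets exhausting the graph, this contradicts \<open>P\<^sub>t 1 = 1\<close> for large \<open>t\<close>.
\<close>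

subsection \<open>The Hilbert space of square-summable functions\<close>

lemma summable_on_mult_square:
  fixes f g :: "'a \<Rightarrow> real"
  assumes "(\<lambda>x. (f x)\<^sup>2) summable_on A" "(\<lambda>x. (g x)\<^sup>2) summable_on A"
  shows "(\<lambda>x. f x * g x) summable_on A"
proof (rule abs_summable_summable, rule summable_on_comparison_test)
  show "(\<lambda>x. (f x)\<^sup>2 + (g x)\<^sup>2) summable_on A"
    by (intro summable_on_add assms)
  show "norm (f x * g x) \<le> (f x)\<^sup>2 + (g x)\<^sup>2" for x
    using sum_squares_bound[of "\<bar>f x\<bar>" "\<bar>g x\<bar>"] mult_nonneg_nonneg[OF abs_ge_zero abs_ge_zero, of "f x" "g x"]
    by (simp add: abs_mult del: zero_le_mult_iff mult_nonneg_nonneg)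
qed auto

lemma summable_on_square_add:
  fixes f g :: "'a \<Rightarrow> real"
  assumes "(\<lambda>x. (f x)\<^sup>2) summable_on A" "(\<lambda>x. (g x)\<^sup>2) summable_on A"
  shows "(\<lambda>x. (f x + g x)\<^sup>2) summable_on A"
proof -
  have "(\<lambda>x. (f x)\<^sup>2 + (g x)\<^sup>2 + 2 * (f x * g x)) summable_on A"
    by (intro summable_on_add summable_on_cmult_right summable_on_mult_square assms)
  then show ?thesis
    by (simp add: power2_sum mult.assoc)
qed

lemma summable_on_square_scale:
  fixes f :: "'a \<Rightarrow> real"
  assumes "(\<lambda>x. (f x)\<^sup>2) summable_on A"
  shows "(\<lambda>x. (c * f x)\<^sup>2) summable_on A"
  using summable_on_cmult_right[OF assms, of "c\<^sup>2"] by (simp add: power_mult_distrib)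

text \<open>As a type, the square-summable functions become a real Hilbert space in the sense of the
  type classes, so that Cauchy sequences, bounded linear maps and vector-valued derivatives can be
  used for the heat flow.\<close>

typedef 'a l2 = "{f :: 'a \<Rightarrow> real. (\<lambda>x. (f x)\<^sup>2) summable_on UNIV}"
  morphisms l2_apply Abs_l2
  by (rule exI[of _ "\<lambda>_. 0"]) simp

setup_lifting type_definition_l2

lemma summable_l2_apply [simp]: "(\<lambda>x. (l2_apply u x)\<^sup>2) summable_on UNIV"
  using l2_apply by auto

lemma summable_l2_apply_mult [simp]: "(\<lambda>x. l2_apply u x * l2_apply v x) summable_on UNIV"
  by (intro summable_on_mult_square summable_l2_apply)

instantiation l2 :: (type) real_inner
begin

lift_definition zero_l2 :: "'a l2" is "\<lambda>_. 0" by simp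

lift_definition plus_l2 :: "'a l2 \<Rightarrow> 'a l2 \<Rightarrow> 'a l2" is "\<lambda>f g x. f x + g x"
  by (rule summable_on_square_add)

lift_definition uminus_l2 :: "'a l2 \<Rightarrow> 'a l2" is "\<lambda>f x. - f x" by simp

lift_definition minus_l2 :: "'a l2 \<Rightarrow> 'a l2 \<Rightarrow> 'a l2" is "\<lambda>f g x. f x - g x"
  subgoal for f g using summable_on_square_add[of f UNIV "\<lambda>x. - g x"] by simp
  done

lift_definition scaleR_l2 :: "real \<Rightarrow> 'a l2 \<Rightarrow> 'a l2" is "\<lambda>c f x. c * f x"
  by (rule summable_on_square_scale)

definition inner_l2 :: "'a l2 \<Rightarrow> 'a l2 \<Rightarrow> real" where
  "inner_l2 u v = (\<Sum>\<^sub>\<infinity>x. l2_apply u x * l2_apply v x)"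

definition norm_l2 :: "'a l2 \<Rightarrow> real" where "norm_l2 u = sqrt (inner u u)"

definition sgn_l2 :: "'a l2 \<Rightarrow> 'a l2" where "sgn_l2 u = inverse (norm u) *\<^sub>R u"

definition dist_l2 :: "'a l2 \<Rightarrow> 'a l2 \<Rightarrow> real" where "dist_l2 u v = norm (u - v)"

definition uniformity_l2 :: "('a l2 \<times> 'a l2) filter" where
  "uniformity_l2 = (INF e\<in>{0<..}. principal {(u, v). dist u v < e})"

definition open_l2 :: "'a l2 set \<Rightarrow> bool" where
  "open_l2 S \<longleftrightarrow> (\<forall>u\<in>S. \<forall>\<^sub>F (u', v) in uniformity. u' = u \<longrightarrow> v \<in> S)"

instance
proof
  fix u v w :: "'a l2" and r s :: real
  show "u + v + w = u + (v + w)" by transfer (simp add: add.assoc)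
  show "u + v = v + u" by transfer (simp add: add.commute)
  show "0 + u = u" by transfer simp
  show "- u + u = 0" by transfer simp
  show "u - v = u + - v" by transfer simp
  show "r *\<^sub>R (u + v) = r *\<^sub>R u + r *\<^sub>R v" by transfer (simp add: distrib_left)
  show "(r + s) *\<^sub>R u = r *\<^sub>R u + s *\<^sub>R u" by transfer (simp add: distrib_right)
  show "r *\<^sub>R s *\<^sub>R u = (r * s) *\<^sub>R u" by transfer (simp add: mult.assoc)
  show "1 *\<^sub>R u = u" by transfer simp
  show "u \<bullet> v = v \<bullet> u" by (simp add: inner_l2_def mult.commute)
  show "(u + v) \<bullet> w = u \<bullet> w + v \<bullet> w"
    by (simp add: inner_l2_def plus_l2.rep_eq distrib_right infsum_add)
  show "(r *\<^sub>R u) \<bullet> v = r * (u \<bullet> v)"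
    by (simp add: inner_l2_def scaleR_l2.rep_eq mult.assoc infsum_cmult_right')
  show "0 \<le> u \<bullet> u" by (simp add: inner_l2_def infsum_nonneg)
  show "u \<bullet> u = 0 \<longleftrightarrow> u = 0"
  proof
    assume "u \<bullet> u = 0"
    then have "l2_apply u x * l2_apply u x = 0" for x
      unfolding inner_l2_def
      by (intro nonneg_infsum_le_0D[of "\<lambda>x. l2_apply u x * l2_apply u x" UNIV]) auto
    then show "u = 0" by transfer auto
  qed (simp add: inner_l2_def zero_l2.rep_eq)
qed (simp_all add: norm_l2_def sgn_l2_def dist_l2_def uniformity_l2_def open_l2_def)

end

lemmas l2_apply_simps [simp] =
  zero_l2.rep_eq plus_l2.rep_eq uminus_l2.rep_eq minus_l2.rep_eq scaleR_l2.rep_eq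

lemma l2_eqI: "(\<And>x. l2_apply u x = l2_apply v x) \<Longrightarrow> u = v"
  by (metis ext l2_apply_inject)

lemma norm_l2_squared: "(norm u)\<^sup>2 = (\<Sum>\<^sub>\<infinity>x. (l2_apply u x)\<^sup>2)"
  by (simp add: power2_norm_eq_inner inner_l2_def flip: power2_eq_square)

lemma sum_square_le_norm_l2: "finite A \<Longrightarrow> (\<Sum>x\<in>A. (l2_apply u x)\<^sup>2) \<le> (norm u)\<^sup>2"
  unfolding norm_l2_squared by (rule finite_sum_le_infsum) auto

lemma l2_apply_square_le_norm: "(l2_apply u x)\<^sup>2 \<le> (norm u)\<^sup>2"
  using sum_square_le_norm_l2[of "{x}"] by simp

lemma abs_l2_apply_le_norm: "\<bar>l2_apply u x\<bar> \<le> norm u"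
  using l2_apply_square_le_norm[of u x] by (simp flip: abs_le_square_iff)

lemma bounded_linear_l2_apply: "bounded_linear (\<lambda>u. l2_apply u x)"
  by (rule bounded_linear_intro[where K = 1]) (auto simp: abs_l2_apply_le_norm)

lemmas tendsto_l2_apply = bounded_linear.tendsto[OF bounded_linear_l2_apply]

text \<open>The pointwise limit \<open>f\<close> is the only candidate. A Cauchy bound survives the
  limit on every finite set of vertices with the same constant, hence it holds for the full sum of
  squares.\<close>

instance l2 :: (type) banach
proof
  fix X :: "nat \<Rightarrow> 'a l2"
  assume X: "Cauchy X"
  have "Cauchy (\<lambda>n. l2_apply (X n) x)" for x
    by (rule bounded_linear.Cauchy[OF bounded_linear_l2_apply X])
  then have "\<exists>l. (\<lambda>n. l2_apply (X n) x) \<longlonglongrightarrow> l" for x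
    by (simp add: Cauchy_convergent_iff convergent_def)
  then obtain f where f: "\<And>x. (\<lambda>n. l2_apply (X n) x) \<longlonglongrightarrow> f x"
    by metis
  have part: "(\<Sum>x\<in>A. (l2_apply (X n) x - f x)\<^sup>2) \<le> e\<^sup>2"
    if "finite A" "\<And>m. m \<ge> N \<Longrightarrow> norm (X n - X m) < e" for A n N e
  proof (rule tendsto_upperbound)
    show "(\<lambda>m. \<Sum>x\<in>A. (l2_apply (X n) x - l2_apply (X m) x)\<^sup>2) \<longlonglongrightarrow> (\<Sum>x\<in>A. (l2_apply (X n) x - f x)\<^sup>2)"
      by (intro tendsto_intros f)
    have "(\<Sum>x\<in>A. (l2_apply (X n) x - l2_apply (X m) x)\<^sup>2) \<le> e\<^sup>2" if "m \<ge> N" for m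
      using sum_square_le_norm_l2[OF \<open>finite A\<close>, of "X n - X m"]
        power_mono[OF less_imp_le, of "norm (X n - X m)" e 2] that
        \<open>\<And>m. m \<ge> N \<Longrightarrow> norm (X n - X m) < e\<close> by fastforce
    then show "\<forall>\<^sub>F m in sequentially. (\<Sum>x\<in>A. (l2_apply (X n) x - l2_apply (X m) x)\<^sup>2) \<le> e\<^sup>2"
      by (auto simp: eventually_sequentially)
  qed auto
  have summ: "(\<lambda>x. (l2_apply (X n) x - f x)\<^sup>2) summable_on UNIV"
    if "\<And>m. m \<ge> N \<Longrightarrow> norm (X n - X m) < e" for n N e
    by (rule nonneg_bdd_above_summable_on)
      (use that in \<open>auto simp: bdd_above_def intro!: exI[of _ "e\<^sup>2"] part\<close>)
  obtain N where N: "\<And>m n. m \<ge> N \<Longrightarrow> n \<ge> N \<Longrightarrow> norm (X m - X n) < 1"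
    using CauchyD[OF X zero_less_one] by blast
  \<comment> \<open>\<open>f\<close> is \<open>X N\<close> minus the difference
    \<open>X N - f\<close>, and both are square-summable.\<close>
  have "(\<lambda>x. (f x)\<^sup>2) summable_on UNIV"
    using summable_on_square_add[OF summable_l2_apply[of "X N"] 
        summable_on_square_scale[OF summ[OF N[of N]], of N "-1"]] by simp
  then have fapp: "l2_apply (Abs_l2 f) = f"
    by (simp add: Abs_l2_inverse)
  have "X \<longlonglongrightarrow> Abs_l2 f"
  proof (rule LIMSEQ_I)
    fix r :: real assume "r > 0"
    then obtain M where M: "\<And>m n. m \<ge> M \<Longrightarrow> n \<ge> M \<Longrightarrow> norm (X m - X n) < r / 2"
      using CauchyD[OF X, of "r / 2"] by auto
    have "norm (X n - Abs_l2 f) < r" if "n \<ge> M" for n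
    proof -
      have "(norm (X n - Abs_l2 f))\<^sup>2 \<le> (r / 2)\<^sup>2"
        unfolding norm_l2_squared minus_l2.rep_eq fapp
        by (intro infsum_le_finite_sums summ[of M n "r / 2"] part[of _ M]) (use M that in auto)
      then have "norm (X n - Abs_l2 f) \<le> r / 2"
        using \<open>r > 0\<close> by (simp add: power2_le_iff_abs_le)
      then show ?thesis using \<open>r > 0\<close> by simp
    qed
    then show "\<exists>M. \<forall>n\<ge>M. norm (X n - Abs_l2 f) < r" by blast
  qed
  then show "convergent X" by (auto simp: convergent_def)
qed

subsection \<open>Strongly continuous semigroups\<close>

text \<open>By Baire, one of the closed sets \<open>C k\<close> contains a ball; linearity carries
  the bound from that ball to the origin and scaling carries it to all vectors.\<close>

lemma uniform_boundedness:
  fixes T :: "nat \<Rightarrow> 'a::banach \<Rightarrow> 'b::real_normed_vector"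
  assumes lin: "\<And>n. bounded_linear (T n)"
    and bdd: "\<And>x. bounded (range (\<lambda>n. T n x))"
  shows "\<exists>M. \<forall>n x. norm (T n x) \<le> M * norm x"
proof -
  define C where "C k = {x. \<forall>n. norm (T n x) \<le> real k}" for k
  have closed_C: "closed (C k)" for k
    unfolding C_def
    by (intro closed_Collect_all closed_Collect_le continuous_intros
        bounded_linear.continuous_on[OF lin])
  have "\<exists>k. x \<in> C k" for x
  proof -
    obtain B where "\<And>n. norm (T n x) \<le> B"
      using bdd[of x] by (auto simp: bounded_iff)
    moreover obtain k where "B \<le> real k" using real_arch_simple by blast
    ultimately show ?thesis unfolding C_def by (auto intro: order_trans)
  qed
  then have UC: "\<Union>(range C) = UNIV" by auto
  have "\<exists>k. interior (C k) \<noteq> {}"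
  proof (rule ccontr)
    assume "\<not> ?thesis"
    moreover have "Met_TC.mcomplete TYPE('a)" 
      by (auto simp: Met_TC.mcomplete_def MCauchy_iff_Cauchy Cauchy_convergent_iff convergent_def)
    ultimately have "interior (\<Union>(range C)) = {}"
      using Met_TC.metric_Baire_category_alt[of "range C"] closed_C
      by auto
    with UC show False by simp
  qed
  then obtain k z e where e: "e > 0" "cball z e \<subseteq> C k"
    by (meson equals0I mem_interior_cball)
  have "norm (T n x) \<le> (2 * real k / e) * norm x" for n x
  proof (cases "x = 0")
    case True
    then show ?thesis using bounded_linear.linear[OF lin, of n] by (simp add: linear_0)
  next
    case False
    interpret bounded_linear "T n" by (rule lin)
    \<comment> \<open>\<open>T n y\<close> is the difference of the values at \<open>z + y\<close>
      and \<open>z\<close>, both of norm at most \<open>k\<close>; this is where the factor 2 comes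
      from.\<close>
    define y where "y = (e / norm x) *\<^sub>R x"
    have "norm y = e" using False e by (simp add: y_def)
    then have "z + y \<in> C k" "z \<in> C k"
      using e by (auto simp: dist_norm subset_iff)
    then have "norm (T n (z + y) - T n z) \<le> 2 * real k"
      using norm_triangle_ineq4[of "T n (z + y)" "T n z"] by (auto simp: C_def dest!: spec[of _ n])
    then have "(e / norm x) * norm (T n x) \<le> 2 * real k"
      using e by (simp add: add y_def scaleR)
    then show ?thesis using False e by (simp add: field_simps)
  qed
  then show ?thesis by blast
qed

section \<open>Local bounds and strong continuity\<close>

locale c0_semigroup =
  fixes T :: "real \<Rightarrow> 'b::banach \<Rightarrow> 'b"
  assumes bounded_linear_T: "0 \<le> t \<Longrightarrow> bounded_linear (T t)"
    and T_0: "T 0 u = u"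
    and T_add: "0 \<le> s \<Longrightarrow> 0 \<le> t \<Longrightarrow> T (s + t) u = T s (T t u)"
    and T_tendsto_0: "((\<lambda>t. T t u) \<longlongrightarrow> u) (at_right 0)"
begin

text \<open>Otherwise there are times \<open>s n\<close> tending to 0 along which the operators
  violate every linear bound. Every orbit converges along \<open>s\<close>, so it is bounded, which
  contradicts uniform boundedness.\<close>

lemma locally_bounded_at_0: "\<exists>d>0. \<exists>M. \<forall>t\<in>{0..d}. \<forall>u. norm (T t u) \<le> M * norm u"
proof (rule ccontr)
  assume neg: "\<not> ?thesis"
  have "\<exists>t\<in>{0..1 / real (Suc n)}. \<exists>u. norm (T t u) > real n * norm u" for n
    using neg by (meson not_le of_nat_0_less_iff zero_less_Suc zero_less_divide_1_iff)
  then obtain s where s: "\<And>n. s n \<in> {0..1 / real (Suc n)}"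
    and unbdd: "\<And>n. \<exists>u. norm (T (s n) u) > real n * norm u"
    by metis
  have s0: "s \<longlonglongrightarrow> 0"
    by (rule tendsto_sandwich[OF _ _ tendsto_const LIMSEQ_inverse_real_of_nat])
      (use s in \<open>auto simp: inverse_eq_divide intro!: always_eventually\<close>)
  have "bounded (range (\<lambda>n. T (s n) u))" for u
  proof -
    have "((\<lambda>t. T t u) \<longlongrightarrow> T 0 u) (at 0 within {0..})"
      using T_tendsto_0[of u] by (simp add: T_0 at_within_Ici_at_right)
    then have "continuous (at 0 within {0..}) (\<lambda>t. T t u)"
      by (simp add: continuous_within)
    then have "(\<lambda>n. T (s n) u) \<longlonglongrightarrow> T 0 u"
      using s s0 by (auto simp: continuous_within_sequentially o_def)
    then show ?thesis using convergent_imp_bounded by blast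
  qed
  then obtain M where M: "\<And>n u. norm (T (s n) u) \<le> M * norm u"
    using uniform_boundedness[of "\<lambda>n. T (s n)"] s bounded_linear_T by auto
  obtain n where "M \<le> real n" using real_arch_simple by blast
  moreover obtain u where "norm (T (s n) u) > real n * norm u" using unbdd by blast
  ultimately show False
    using M[of n u] mult_right_mono[of M "real n" "norm u"] by simp
qed

text \<open>Left limits at \<open>t\<close> apply \<open>T (t - k)\<close> to vectors that vary with
  \<open>k\<close>, which calls for a bound uniform in \<open>k\<close>. The factorisation
  \<open>T (t - e)\<close> after \<open>T (e - k)\<close> reduces it to the bound near time
  0.\<close>

lemma locally_bounded_left:
  assumes "t > 0"
  shows "\<exists>M. \<forall>\<^sub>F k in at_right 0. \<forall>u. norm (T (t - k) u) \<le> M * norm u"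
proof -
  obtain d M where d: "d > 0" and M: "\<And>s u. s \<in> {0..d} \<Longrightarrow> norm (T s u) \<le> M * norm u"
    using locally_bounded_at_0 by blast
  define e where "e = min d t"
  have e: "0 < e" "e \<le> d" "e \<le> t" using d assms by (auto simp: e_def)
  obtain C where C: "C > 0" "\<And>u. norm (T (t - e) u) \<le> C * norm u"
    using bounded_linear.pos_bounded[OF bounded_linear_T[of "t - e"]] e
    by (auto simp: mult.commute)
  have "norm (T (t - k) u) \<le> C * M * norm u" if "k \<in> {0<..<e}" for k u
  proof -
    have "T (t - k) u = T (t - e) (T (e - k) u)"
      using T_add[of "t - e" "e - k" u] that e by simp
    also have "norm \<dots> \<le> C * (M * norm u)"
      using C(2)[of "T (e - k) u"] mult_left_mono[OF M[of "e - k" u], of C] that e C(1)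
      by (simp add: order_trans)
    finally show ?thesis by (simp add: mult.assoc)
  qed
  then have "\<forall>\<^sub>F k in at_right 0. \<forall>u. norm (T (t - k) u) \<le> C * M * norm u"
    using e(1) by (auto simp: eventually_at_right_field)
  then show ?thesis by blast
qed

text \<open>The difference is \<open>T (t - k)\<close> applied to \<open>u - T k u\<close>, a vector
  tending to 0 under operators that are uniformly bounded.\<close>

lemma tendsto_T_left:
  assumes "t > 0"
  shows "((\<lambda>k. T (t - k) u) \<longlongrightarrow> T t u) (at_right 0)"
proof -
  obtain M where M: "\<forall>\<^sub>F k in at_right 0. \<forall>u. norm (T (t - k) u) \<le> M * norm u"
    using locally_bounded_left[OF assms] by blast
  have "((\<lambda>k. M * norm (u - T k u)) \<longlongrightarrow> M * norm (u - u)) (at_right 0)"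
    by (intro tendsto_intros T_tendsto_0)
  then have lim: "((\<lambda>k. M * norm (u - T k u)) \<longlongrightarrow> 0) (at_right 0)" by simp
  have "\<forall>\<^sub>F k in at_right 0. k \<in> {0<..<t}"
    using assms eventually_at_right_real by blast
  with M have "\<forall>\<^sub>F k in at_right 0. norm (T (t - k) u - T t u) \<le> M * norm (u - T k u)"
  proof eventually_elim
    case (elim k)
    interpret bounded_linear "T (t - k)" using elim by (intro bounded_linear_T) simp
    have "T (t - k) u - T t u = T (t - k) (u - T k u)"
      using T_add[of "t - k" k u] elim by (simp add: diff)
    then show ?case using elim by metis
  qed
  then have "((\<lambda>k. T (t - k) u - T t u) \<longlongrightarrow> 0) (at_right 0)"
    by (rule Lim_null_comparison[OF _ lim])
  then show ?thesis by (simp add: LIM_zero_iff)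
qed

lemma continuous_on_T: "continuous_on {0..} (\<lambda>t. T t u)"
  unfolding continuous_on_def
proof
  fix t :: real assume "t \<in> {0..}"
  show "((\<lambda>t. T t u) \<longlongrightarrow> T t u) (at t within {0..})"
  proof (cases "t = 0")
    case True
    then show ?thesis using T_tendsto_0[of u] by (simp add: T_0 at_within_Ici_at_right)
  next
    case False
    with \<open>t \<in> {0..}\<close> have t: "t > 0" by simp
    have "((\<lambda>h. T t (T h u)) \<longlongrightarrow> T t u) (at_right 0)"
      using t by (intro bounded_linear.tendsto[OF bounded_linear_T] T_tendsto_0) auto
    moreover have "\<forall>\<^sub>F h in at_right 0. T t (T h u) = T (t + h) u"
      using t T_add[of t _ u] by (auto simp: eventually_at_right_field intro!: exI[of _ 1])
    ultimately have "((\<lambda>h. T (t + h) u) \<longlongrightarrow> T t u) (at_right 0)"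
      by (rule Lim_transform_eventually)
    moreover have "((\<lambda>h. T (t + h) u) \<longlongrightarrow> T t u) (at_left 0)"
      using tendsto_T_left[OF t] by (simp add: filterlim_at_left_to_right)
    ultimately have "((\<lambda>h. T (t + h) u) \<longlongrightarrow> T t u) (at 0)"
      by (simp add: filterlim_split_at)
    then have "((\<lambda>t. T t u) \<longlongrightarrow> T t u) (at t)"
      by (rule LIM_offset_zero_cancel)
    then show ?thesis by (rule tendsto_within_subset) simp
  qed
qed

section \<open>The generator and differentiability of orbits\<close>

definition gen :: "'b \<Rightarrow> 'b \<Rightarrow> bool" where
  "gen u g \<longleftrightarrow> ((\<lambda>h. (T h u - u) /\<^sub>R h) \<longlongrightarrow> g) (at_right 0)"

lemma gen_diff:
  assumes "gen u g" "gen v h"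
  shows "gen (u - v) (g - h)"
proof -
  have "((\<lambda>k. (T k u - u) /\<^sub>R k - (T k v - v) /\<^sub>R k) \<longlongrightarrow> g - h) (at_right 0)"
    using assms by (intro tendsto_intros) (auto simp: gen_def)
  moreover have "\<forall>\<^sub>F k in at_right (0::real). (T k u - u) /\<^sub>R k - (T k v - v) /\<^sub>R k = (T k (u - v) - (u - v)) /\<^sub>R k"
    using eventually_at_right_less
  proof eventually_elim
    case (elim k)
    interpret bounded_linear "T k" using elim by (intro bounded_linear_T) simp
    show ?case by (simp add: diff scaleR_diff_right)
  qed
  ultimately show ?thesis unfolding gen_def by (rule Lim_transform_eventually)
qed

lemma gen_quotient_eq:
  assumes "t \<ge> 0" "h > 0"
  shows "(T (t + h) u - T t u) /\<^sub>R h = T t ((T h u - u) /\<^sub>R h)"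
proof -
  interpret bounded_linear "T t" by (rule bounded_linear_T[OF assms(1)])
  show ?thesis using assms by (simp add: T_add scaleR diff)
qed

lemma gen_T_quotient:
  assumes "gen u g" "t \<ge> 0"
  shows "((\<lambda>h. (T (t + h) u - T t u) /\<^sub>R h) \<longlongrightarrow> T t g) (at_right 0)"
proof -
  have "((\<lambda>h. T t ((T h u - u) /\<^sub>R h)) \<longlongrightarrow> T t g) (at_right 0)"
    using assms by (intro bounded_linear.tendsto[OF bounded_linear_T]) (auto simp: gen_def)
  moreover have "\<forall>\<^sub>F h in at_right 0. T t ((T h u - u) /\<^sub>R h) = (T (t + h) u - T t u) /\<^sub>R h"
    using gen_quotient_eq[OF assms(2)] by (auto simp: eventually_at_right_field intro!: exI[of _ 1])
  ultimately show ?thesis by (rule Lim_transform_eventually)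
qed

lemma gen_T:
  assumes "gen u g" "t \<ge> 0"
  shows "gen (T t u) (T t g)"
proof -
  have "\<forall>\<^sub>F h in at_right 0. (T (t + h) u - T t u) /\<^sub>R h = (T h (T t u) - T t u) /\<^sub>R h"
    using assms(2) T_add[of _ t u] by (auto simp: eventually_at_right_field add.commute intro!: exI[of _ 1])
  then show ?thesis
    unfolding gen_def by (rule Lim_transform_eventually[OF gen_T_quotient[OF assms]])
qed

text \<open>The right quotient is handled by \<open>gen_T_quotient\<close>. The left quotient over a
  step \<open>k\<close> equals \<open>T (t - k) (z k)\<close> with \<open>z k\<close> tending to
  \<open>g\<close>; it is split into \<open>T (t - k) (z k - g)\<close>, which vanishes by the local
  bound, and \<open>T (t - k) g\<close>, which converges by left continuity.\<close>

lemma has_vector_derivative_T: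
  assumes "gen u g" "t > 0"
  shows "((\<lambda>t. T t u) has_vector_derivative T t g) (at t)"
proof -
  obtain M where M: "\<forall>\<^sub>F k in at_right 0. \<forall>u. norm (T (t - k) u) \<le> M * norm u"
    using locally_bounded_left[OF assms(2)] by blast
  define z where "z k = (T k u - u) /\<^sub>R k" for k
  have z: "(z \<longlongrightarrow> g) (at_right 0)" using assms(1) by (simp add: gen_def z_def[abs_def])
  have "((\<lambda>k. M * norm (z k - g)) \<longlongrightarrow> M * norm (g - g)) (at_right 0)"
    by (intro tendsto_intros z)
  then have lim: "((\<lambda>k. M * norm (z k - g)) \<longlongrightarrow> 0) (at_right 0)" by simp
  have "((\<lambda>k. T (t - k) (z k - g)) \<longlongrightarrow> 0) (at_right 0)"
    by (rule Lim_null_comparison[OF _ lim]) (use M in eventually_elim, blast)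
  then have "((\<lambda>k. T (t - k) (z k - g) + T (t - k) g) \<longlongrightarrow> 0 + T t g) (at_right 0)"
    by (intro tendsto_add tendsto_T_left assms)
  moreover have "\<forall>\<^sub>F k in at_right 0. k \<in> {0<..<t}"
    using assms eventually_at_right_real by blast
  then have "\<forall>\<^sub>F k in at_right 0. T (t - k) (z k - g) + T (t - k) g = (T (t + - k) u - T t u) /\<^sub>R (- k)"
  proof eventually_elim
    case (elim k)
    interpret bounded_linear "T (t - k)" using elim by (intro bounded_linear_T) simp
    have "(T t u - T (t - k) u) /\<^sub>R k = T (t - k) (z k)"
      using gen_quotient_eq[of "t - k" k u] elim by (simp add: z_def)
    then show ?case by (simp add: diff scaleR_diff_right)
  qed
  ultimately have "((\<lambda>k. (T (t + - k) u - T t u) /\<^sub>R (- k)) \<longlongrightarrow> T t g) (at_right 0)"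
    by (auto dest: Lim_transform_eventually)
  then have "((\<lambda>h. (T (t + h) u - T t u) /\<^sub>R h) \<longlongrightarrow> T t g) (at_left 0)"
    by (simp add: filterlim_at_left_to_right)
  then have lim: "((\<lambda>h. (T (t + h) u - T t u) /\<^sub>R h) \<longlongrightarrow> T t g) (at 0)"
    using gen_T_quotient[OF assms(1)] assms(2) by (simp add: filterlim_split_at)
  then have "((\<lambda>h. norm ((T (t + h) u - T t u) /\<^sub>R h - T t g)) \<longlongrightarrow> 0) (at 0)"
    by (simp add: LIM_zero tendsto_norm_zero)
  moreover have "norm ((T (t + h) u - T t u) /\<^sub>R h - T t g)
      = norm (T (t + h) u - T t u - h *\<^sub>R T t g) / norm h" if "h \<noteq> 0" for h
  proof -
    have "T (t + h) u - T t u - h *\<^sub>R T t g = h *\<^sub>R ((T (t + h) u - T t u) /\<^sub>R h - T t g)"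
      using that by (simp add: scaleR_diff_right)
    then show ?thesis using that by simp
  qed
  then have "\<forall>\<^sub>F h in at 0. norm ((T (t + h) u - T t u) /\<^sub>R h - T t g)
      = norm (T (t + h) u - T t u - h *\<^sub>R T t g) / norm h"
    by (auto simp: eventually_at_filter)
  ultimately have "((\<lambda>h. norm (T (t + h) u - T t u - h *\<^sub>R T t g) / norm h) \<longlongrightarrow> 0) (at 0)"
    by (rule Lim_transform_eventually)
  then show ?thesis
    unfolding has_vector_derivative_def has_derivative_at
    by (auto intro: bounded_linear_scaleR_left)
qed

end

subsection \<open>The form of the Laplacian and its closure\<close>

lemma ell2_one_iff: "f \<in> ell2 (\<lambda>_. 1) \<longleftrightarrow> (\<exists>u. f = l2_apply u)"
  unfolding ell2_def by (auto intro: exI[of _ "Abs_l2 f"] simp: Abs_l2_inverse)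

lemma l2_apply_in_ell2 [simp]: "l2_apply u \<in> ell2 (\<lambda>_. 1)"
  by (auto simp: ell2_one_iff)

lemma ell2_inner_l2: "ell2_inner (\<lambda>_. 1) (l2_apply u) (l2_apply v) = u \<bullet> v"
  by (simp add: ell2_inner_def inner_l2_def)

lemma ell2_norm_l2: "ell2_norm (\<lambda>_. 1) (l2_apply u) = norm u"
  by (simp add: ell2_norm_def ell2_inner_l2 norm_eq_sqrt_inner)

lemma fin_supp_l2: "f \<in> fin_supp \<Longrightarrow> l2_apply (Abs_l2 f) = f"
proof -
  assume f: "f \<in> fin_supp"
  have "(\<lambda>x. (f x)\<^sup>2) summable_on UNIV \<longleftrightarrow> (\<lambda>x. (f x)\<^sup>2) summable_on {x. f x \<noteq> 0}"
    by (rule summable_on_cong_neutral) auto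
  then have "(\<lambda>x. (f x)\<^sup>2) summable_on UNIV"
    using f by (simp add: fin_supp_def)
  then show ?thesis by (simp add: Abs_l2_inverse)
qed

lemma fin_supp_lincomb:
  "\<phi> \<in> fin_supp \<Longrightarrow> \<psi> \<in> fin_supp \<Longrightarrow> (\<lambda>x. s * \<phi> x + t * \<psi> x) \<in> fin_supp"
  unfolding fin_supp_def
  by (auto intro: finite_subset[of _ "{x. \<phi> x \<noteq> 0} \<union> {x. \<psi> x \<noteq> 0}"])

lemma fin_supp_diff: "\<phi> \<in> fin_supp \<Longrightarrow> \<psi> \<in> fin_supp \<Longrightarrow> (\<lambda>x. \<phi> x - \<psi> x) \<in> fin_supp"
  using fin_supp_lincomb[of \<phi> \<psi> 1 "-1"] by simp

lemma fin_supp_mult: "\<phi> \<in> fin_supp \<Longrightarrow> (\<lambda>x. \<phi> x * g x) \<in> fin_supp"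
  unfolding fin_supp_def by (auto intro: finite_subset[of _ "{x. \<phi> x \<noteq> 0}"])

lemma fin_supp_indicator: "finite A \<Longrightarrow> indicator A \<in> fin_supp"
  unfolding fin_supp_def by (auto simp: indicator_def)

locale unit_measure_graph =
  fixes b :: "'a \<Rightarrow> 'a \<Rightarrow> real"
  assumes graph: "locally_finite_graph b (\<lambda>_. 1)"
begin

abbreviation lap :: "('a \<Rightarrow> real) \<Rightarrow> 'a \<Rightarrow> real" where
  "lap \<equiv> laplacian b (\<lambda>_. 1)"

text \<open>The carre du champ in a form that is visibly nonnegative on the diagonal;
  \<open>Gamma_op_1\<close> identifies it with the first iterate of \<open>Gamma_op\<close>.\<close>

definition Gamma :: "('a \<Rightarrow> real) \<Rightarrow> ('a \<Rightarrow> real) \<Rightarrow> 'a \<Rightarrow> real" where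
  "Gamma f g x = (\<Sum>y\<in>{y. 0 < b x y}. b x y * (f y - f x) * (g y - g x)) / 2"

abbreviation nbrs :: "'a \<Rightarrow> 'a set" where
  "nbrs x \<equiv> {y. 0 < b x y}"

abbreviation Q :: "('a \<Rightarrow> real) \<Rightarrow> ('a \<Rightarrow> real) \<Rightarrow> real" where
  "Q \<equiv> pre_form b (\<lambda>_. 1)"

section \<open>Pointwise identities and Green's formula\<close>

lemma weight_nonneg [simp]: "0 \<le> b x y"
  and weight_commute: "b x y = b y x"
  and finite_nbrs [simp]: "finite (nbrs x)"
  using graph by (auto simp: locally_finite_graph_def)

lemma weight_le_0_iff [simp]: "b x y \<le> 0 \<longleftrightarrow> b x y = 0"
  using weight_nonneg[of x y] by linarith

lemma lap_eq: "lap f x = (\<Sum>y\<in>nbrs x. b x y * (f y - f x))"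
  by (simp add: laplacian_def)

lemma lap_lincomb: "lap (\<lambda>x. s * f x + t * g x) x = s * lap f x + t * lap g x"
  unfolding lap_eq sum_distrib_left sum.distrib[symmetric]
  by (rule sum.cong) (auto simp: algebra_simps)

lemma Gamma_op_1: "Gamma_op b (\<lambda>_. 1) 1 f g x = Gamma f g x"
proof -
  have "(\<Sum>y\<in>nbrs x. b x y * (f y * g y - f x * g x)) - f x * (\<Sum>y\<in>nbrs x. b x y * (g y - g x))
       - (\<Sum>y\<in>nbrs x. b x y * (f y - f x)) * g x
      = (\<Sum>y\<in>nbrs x. b x y * (f y - f x) * (g y - g x))"
    unfolding sum_distrib_left sum_distrib_right sum_subtractf[symmetric]
    by (rule sum.cong) (auto simp: algebra_simps)
  then show ?thesis by (simp add: lap_eq Gamma_def)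
qed

lemma Gamma_nonneg [simp]: "0 \<le> Gamma f f x"
  unfolding Gamma_def by (auto intro!: sum_nonneg divide_nonneg_nonneg simp: mult.assoc)

lemma lap_square: "lap (\<lambda>x. (f x)\<^sup>2) x = 2 * Gamma f f x + 2 * f x * lap f x"
  using Gamma_op_1[of f f x] by (simp add: power2_eq_square)

lemma lap_fin_supp:
  assumes "f \<in> fin_supp"
  shows "lap f \<in> fin_supp"
proof -
  let ?S = "{x. f x \<noteq> 0}"
  have "lap f x = 0" if "x \<notin> ?S \<union> (\<Union>y\<in>?S. nbrs y)" for x
    unfolding lap_eq using that by (intro sum.neutral) (auto simp: weight_commute[of x])
  then have "{x. lap f x \<noteq> 0} \<subseteq> ?S \<union> (\<Union>y\<in>?S. nbrs y)"
    by blast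
  then show ?thesis
    using assms unfolding fin_supp_def by (auto intro: finite_subset)
qed

text \<open>Both sides reduce to finite sums over the support \<open>S\<close> of \<open>f\<close>
  and its closed neighbourhood \<open>N\<close>, outside of which \<open>lap f\<close> vanishes. The
  sums are then interchanged and \<open>b\<close> is symmetric. As \<open>g\<close> is arbitrary, it
  may be the constant 1.\<close>

lemma lap_green:
  assumes "f \<in> fin_supp"
  shows "(\<Sum>\<^sub>\<infinity>x. lap f x * g x) = (\<Sum>\<^sub>\<infinity>x. f x * lap g x)"
proof -
  define S where "S = {x. f x \<noteq> 0}"
  define N where "N = S \<union> (\<Union>y\<in>S. nbrs y)"
  define d where "d x = (\<Sum>y\<in>nbrs x. b x y)" for x
  have fin: "finite S" "finite N"
    using assms by (auto simp: S_def N_def fin_supp_def)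
  have lap_split: "lap h x = (\<Sum>y\<in>nbrs x. b x y * h y) - d x * h x" for h x
    unfolding lap_eq d_def by (simp only: right_diff_distrib sum_subtractf sum_distrib_right)
  have lap_f: "lap f x = (\<Sum>y\<in>S. b x y * f y) - d x * f x" for x
  proof -
    have "(\<Sum>y\<in>nbrs x. b x y * f y) = (\<Sum>y\<in>S. b x y * f y)"
      by (rule sum.mono_neutral_cong) (use fin in \<open>auto simp: S_def not_less\<close>)
    then show ?thesis by (simp add: lap_split)
  qed
  have lap_g: "lap g x = (\<Sum>y\<in>N. b x y * g y) - d x * g x" if "x \<in> S" for x
  proof -
    have "(\<Sum>y\<in>nbrs x. b x y * g y) = (\<Sum>y\<in>N. b x y * g y)"
      by (rule sum.mono_neutral_left) (use fin that in \<open>auto simp: N_def not_less\<close>)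
    then show ?thesis by (simp add: lap_split)
  qed
  have "(\<Sum>\<^sub>\<infinity>x. lap f x * g x) = (\<Sum>\<^sub>\<infinity>x\<in>N. lap f x * g x)"
  proof (rule infsum_cong_neutral)
    fix x assume "x \<in> UNIV - N"
    then have "f x = 0" "\<And>y. y \<in> S \<Longrightarrow> b y x = 0"
      by (auto simp: S_def N_def not_less)
    then have "f x = 0" "\<And>y. y \<in> S \<Longrightarrow> b x y = 0"
      using weight_commute[of x] by metis+
    then show "lap f x * g x = 0" by (simp add: lap_f)
  qed auto
  also have "\<dots> = (\<Sum>x\<in>N. \<Sum>y\<in>S. b x y * f y * g x) - (\<Sum>x\<in>N. d x * f x * g x)"
    by (simp add: fin lap_f left_diff_distrib sum_subtractf sum_distrib_right)
  also have "(\<Sum>x\<in>N. d x * f x * g x) = (\<Sum>x\<in>S. d x * f x * g x)"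
    by (rule sum.mono_neutral_right) (use fin in \<open>auto simp: N_def S_def\<close>)
  also have "(\<Sum>x\<in>N. \<Sum>y\<in>S. b x y * f y * g x) = (\<Sum>y\<in>S. f y * (\<Sum>x\<in>N. b y x * g x))"
    by (subst sum.swap) (auto simp: sum_distrib_left weight_commute mult_ac intro!: sum.cong)
  also have "\<dots> - (\<Sum>x\<in>S. d x * f x * g x) = (\<Sum>x\<in>S. f x * lap g x)"
    by (simp add: lap_g right_diff_distrib sum_subtractf mult_ac)
  also have "\<dots> = (\<Sum>\<^sub>\<infinity>x\<in>S. f x * lap g x)"
    using fin by simp
  also have "\<dots> = (\<Sum>\<^sub>\<infinity>x. f x * lap g x)"
    by (rule infsum_cong_neutral) (auto simp: S_def)
  finally show ?thesis .
qed

section \<open>The energy form on finitely supported functions\<close>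

lemma Q_eq_infsum: "Q \<phi> \<psi> = - (\<Sum>\<^sub>\<infinity>x. lap \<phi> x * \<psi> x)"
  by (simp add: pre_form_def ell2_inner_def infsum_uminus)

lemma Q_commute: "\<phi> \<in> fin_supp \<Longrightarrow> Q \<phi> \<psi> = Q \<psi> \<phi>"
  by (simp add: Q_eq_infsum lap_green mult.commute[of "\<psi> _"] mult.commute[of "lap \<psi> _"])

lemma Q_eq_inner:
  assumes "\<phi> \<in> fin_supp" 
  shows "Q \<phi> (l2_apply v) = - (Abs_l2 (lap \<phi>) \<bullet> v)"
  using assms by (simp add: Q_eq_infsum inner_l2_def fin_supp_l2 lap_fin_supp)

lemma Q_eq_inner_Abs:
  assumes "\<phi> \<in> fin_supp" "\<psi> \<in> fin_supp"
  shows "Q \<phi> \<psi> = - (Abs_l2 (lap \<phi>) \<bullet> Abs_l2 \<psi>)"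
  using Q_eq_inner[OF assms(1), of "Abs_l2 \<psi>"] assms(2) by (simp add: fin_supp_l2)

lemma Q_lincomb_left:
  assumes "\<phi> \<in> fin_supp" "\<phi>' \<in> fin_supp" "\<psi> \<in> fin_supp"
  shows "Q (\<lambda>x. s * \<phi> x + t * \<phi>' x) \<psi> = s * Q \<phi> \<psi> + t * Q \<phi>' \<psi>"
proof -
  have "Abs_l2 (lap (\<lambda>x. s * \<phi> x + t * \<phi>' x)) = s *\<^sub>R Abs_l2 (lap \<phi>) + t *\<^sub>R Abs_l2 (lap \<phi>')"
    by (rule l2_eqI) (simp add: fin_supp_l2 lap_fin_supp fin_supp_lincomb assms lap_lincomb)
  then show ?thesis
    by (simp add: Q_eq_inner_Abs fin_supp_lincomb assms inner_add_left)
qed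

lemma Q_diff_left:
  assumes "\<phi> \<in> fin_supp" "\<phi>' \<in> fin_supp" "\<psi> \<in> fin_supp"
  shows "Q (\<lambda>x. \<phi> x - \<phi>' x) \<psi> = Q \<phi> \<psi> - Q \<phi>' \<psi>"
  using Q_lincomb_left[OF assms, of 1 "-1"] by simp

text \<open>Summing \<open>lap_square\<close> over all vertices gives the energy, because the total
  sum of the Laplacian of \<open>f^2\<close> is zero: Green's formula moves the Laplacian onto the
  constant 1.\<close>

lemma Q_eq_sum_Gamma:
  assumes f: "f \<in> fin_supp"
  shows "finite {x. Gamma f f x \<noteq> 0}" "Q f f = (\<Sum>x | Gamma f f x \<noteq> 0. Gamma f f x)"
proof -
  have f2: "(\<lambda>x. (f x)\<^sup>2) \<in> fin_supp"
    using fin_supp_mult[OF f, of f] by (simp add: power2_eq_square)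
  have G: "Gamma f f = (\<lambda>x. (1/2) * lap (\<lambda>x. (f x)\<^sup>2) x + (-1) * (f x * lap f x))"
    by (rule ext) (simp add: lap_square add_divide_distrib)
  have "Gamma f f \<in> fin_supp"
    unfolding G by (intro fin_supp_lincomb lap_fin_supp fin_supp_mult f f2)
  then show fin: "finite {x. Gamma f f x \<noteq> 0}" by (simp add: fin_supp_def)
  have summable: "h summable_on UNIV" if "h \<in> fin_supp" for h :: "'a \<Rightarrow> real"
    by (rule has_sum_imp_summable, rule has_sum_finite_neutralI[OF _ _ _ refl, of "{x. h x \<noteq> 0}"])
      (use that in \<open>auto simp: fin_supp_def\<close>)
  have "(\<Sum>\<^sub>\<infinity>x. lap (\<lambda>x. (f x)\<^sup>2) x) = 0"
    using lap_green[OF f2, of "\<lambda>_. 1"] by (simp add: lap_eq)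
  moreover have "(\<Sum>\<^sub>\<infinity>x. Gamma f f x)
      = (\<Sum>\<^sub>\<infinity>x. (1/2) * lap (\<lambda>x. (f x)\<^sup>2) x) + (\<Sum>\<^sub>\<infinity>x. (-1) * (f x * lap f x))"
    unfolding G
    by (intro infsum_add summable_on_cmult_right summable lap_fin_supp fin_supp_mult f f2)
  ultimately have "(\<Sum>\<^sub>\<infinity>x. Gamma f f x) = - (\<Sum>\<^sub>\<infinity>x. f x * lap f x)"
    unfolding infsum_cmult_right' by simp
  also have "\<dots> = Q f f" by (simp add: Q_eq_infsum mult.commute)
  also have "(\<Sum>\<^sub>\<infinity>x. Gamma f f x) = (\<Sum>\<^sub>\<infinity>x\<in>{x. Gamma f f x \<noteq> 0}. Gamma f f x)"
    by (rule infsum_cong_neutral) auto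
  finally show "Q f f = (\<Sum>x | Gamma f f x \<noteq> 0. Gamma f f x)" using fin by simp
qed

lemma sum_Gamma_le_Q:
  assumes "f \<in> fin_supp" "finite A"
  shows "(\<Sum>x\<in>A. Gamma f f x) \<le> Q f f"
proof -
  have "(\<Sum>x\<in>A. Gamma f f x) = (\<Sum>x\<in>A \<inter> {x. Gamma f f x \<noteq> 0}. Gamma f f x)"
    by (rule sum.mono_neutral_right) (use assms in auto)
  also have "\<dots> \<le> Q f f"
    unfolding Q_eq_sum_Gamma(2)[OF assms(1)]
    by (rule sum_mono2) (use Q_eq_sum_Gamma(1)[OF assms(1)] in auto)
  finally show ?thesis .
qed

lemma Q_nonneg: "f \<in> fin_supp \<Longrightarrow> 0 \<le> Q f f"
  using sum_Gamma_le_Q[of f "{}"] by simp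

lemma Q_lincomb_lincomb:
  assumes "\<phi> \<in> fin_supp" "\<psi> \<in> fin_supp"
  shows "Q (\<lambda>x. s * \<phi> x + t * \<psi> x) (\<lambda>x. s * \<phi> x + t * \<psi> x)
    = s\<^sup>2 * Q \<phi> \<phi> + 2 * s * t * Q \<phi> \<psi> + t\<^sup>2 * Q \<psi> \<psi>"
proof -
  note fs = fin_supp_lincomb[OF assms, of s t]
  show ?thesis
    unfolding Q_lincomb_left[OF assms fs] Q_commute[OF assms(1), of "\<lambda>x. s * \<phi> x + t * \<psi> x"]
      Q_commute[OF assms(2), of "\<lambda>x. s * \<phi> x + t * \<psi> x"]
      Q_lincomb_left[OF assms assms(1)] Q_lincomb_left[OF assms assms(2)] Q_commute[OF assms(2), of \<phi>]
    by (simp add: power2_eq_square algebra_simps)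
qed

lemma Q_diff_diff:
  assumes "\<phi> \<in> fin_supp" "\<psi> \<in> fin_supp"
  shows "Q (\<lambda>x. \<phi> x - \<psi> x) (\<lambda>x. \<phi> x - \<psi> x) = Q \<phi> \<phi> - 2 * Q \<phi> \<psi> + Q \<psi> \<psi>"
  using Q_lincomb_lincomb[OF assms, of 1 "-1"] by simp

lemma Q_diff_le:
  assumes "\<phi> \<in> fin_supp" "\<psi> \<in> fin_supp"
  shows "Q (\<lambda>x. \<phi> x - \<psi> x) (\<lambda>x. \<phi> x - \<psi> x) \<le> 2 * Q \<phi> \<phi> + 2 * Q \<psi> \<psi>"
  using Q_lincomb_lincomb[OF assms, of 1 1] Q_nonneg[OF fin_supp_lincomb[OF assms, of 1 1]]
    Q_diff_diff[OF assms] by simp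

text \<open>A form of the Cauchy-Schwarz inequality that avoids square roots of the energy.\<close>

lemma Q_small:
  assumes "B > 0" "e > 0"
  shows "\<exists>d>0. \<forall>\<phi>\<in>fin_supp. \<forall>\<psi>\<in>fin_supp. Q \<phi> \<phi> < d \<longrightarrow> Q \<psi> \<psi> \<le> B \<longrightarrow> \<bar>Q \<phi> \<psi>\<bar> < e"
proof (intro exI conjI ballI impI)
  show "e\<^sup>2 / B > 0" using assms by simp
  fix \<phi> \<psi> assume f: "\<phi> \<in> fin_supp" "\<psi> \<in> fin_supp" and small: "Q \<phi> \<phi> < e\<^sup>2 / B" "Q \<psi> \<psi> \<le> B"
  \<comment> \<open>Positivity is used at \<open>B * \<phi> + t * \<psi>\<close> for
    \<open>t = e\<close> and \<open>t = - e\<close>; these weights balance the two energies, so that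
    the bound becomes exactly \<open>2 * B * e * e\<close>.\<close>
  have "0 \<le> B\<^sup>2 * Q \<phi> \<phi> + 2 * B * t * Q \<phi> \<psi> + t\<^sup>2 * Q \<psi> \<psi>" for t
    using Q_lincomb_lincomb[OF f, of B t] Q_nonneg[OF fin_supp_lincomb[OF f, of B t]] by simp
  from this[of e] this[of "-e"]
  have "2 * B * e * \<bar>Q \<phi> \<psi>\<bar> \<le> B\<^sup>2 * Q \<phi> \<phi> + e\<^sup>2 * Q \<psi> \<psi>"
    by (cases "Q \<phi> \<psi> \<ge> 0") auto
  also have "\<dots> < B\<^sup>2 * (e\<^sup>2 / B) + e\<^sup>2 * B"
    by (intro add_less_le_mono mult_strict_left_mono mult_left_mono) (use small assms in auto)
  also have "\<dots> = 2 * B * e * e"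
    using assms by (simp add: power2_eq_square)
  finally show "\<bar>Q \<phi> \<psi>\<bar> < e" using assms by (simp add: mult_less_cancel_left)
qed

section \<open>Closability and the closed form\<close>

abbreviation approx :: "(nat \<Rightarrow> 'a \<Rightarrow> real) \<Rightarrow> ('a \<Rightarrow> real) \<Rightarrow> bool" where
  "approx \<equiv> form_approx b (\<lambda>_. 1)"

lemma approx_fin_supp: "approx \<phi> u \<Longrightarrow> \<phi> n \<in> fin_supp"
  by (simp add: form_approx_def)

lemma approx_tendsto:
  assumes "approx \<phi> (l2_apply u)"
  shows "(\<lambda>n. Abs_l2 (\<phi> n)) \<longlonglongrightarrow> u"
proof -
  have "ell2_norm (\<lambda>_. 1) (\<lambda>x. \<phi> n x - l2_apply u x) = norm (Abs_l2 (\<phi> n) - u)" for n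
    using ell2_norm_l2[of "Abs_l2 (\<phi> n) - u"]
    by (simp add: minus_l2.rep_eq[abs_def] fin_supp_l2 approx_fin_supp[OF assms])
  then have "(\<lambda>n. norm (Abs_l2 (\<phi> n) - u)) \<longlonglongrightarrow> 0"
    using assms by (simp add: form_approx_def)
  then show ?thesis by (simp add: tendsto_iff dist_norm)
qed

lemma approx_ell2:
  assumes "approx \<phi> u"
  obtains u' where "u = l2_apply u'"
  using assms by (auto simp: form_approx_def ell2_one_iff)

lemma approx_tendsto_pointwise:
  assumes "approx \<phi> u"
  shows "(\<lambda>n. \<phi> n x) \<longlonglongrightarrow> u x"
proof -
  obtain u' where u': "u = l2_apply u'" using approx_ell2[OF assms] .
  show ?thesis
    using tendsto_l2_apply[OF approx_tendsto[OF assms[unfolded u']], of x]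
    by (simp add: u' fin_supp_l2 approx_fin_supp[OF assms])
qed

lemma approx_Cauchy:
  assumes "approx \<phi> u" "e > 0"
  shows "\<exists>N. \<forall>i\<ge>N. \<forall>j\<ge>N. Q (\<lambda>x. \<phi> i x - \<phi> j x) (\<lambda>x. \<phi> i x - \<phi> j x) < e"
  using assms unfolding form_approx_def by blast

text \<open>From an index \<open>N\<close> on, \<open>\<phi> n\<close> differs from the fixed
  function \<open>\<phi> N\<close> by a function of energy less than 1.\<close>

lemma approx_Q_bounded:
  assumes "approx \<phi> u"
  shows "\<exists>B>0. \<exists>N. \<forall>n\<ge>N. Q (\<phi> n) (\<phi> n) \<le> B"
proof -
  obtain N where N: "\<And>i j. i \<ge> N \<Longrightarrow> j \<ge> N \<Longrightarrow> Q (\<lambda>x. \<phi> i x - \<phi> j x) (\<lambda>x. \<phi> i x - \<phi> j x) < 1"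
    using approx_Cauchy[OF assms zero_less_one] by blast
  have "Q (\<phi> n) (\<phi> n) \<le> 2 * Q (\<phi> N) (\<phi> N) + 2" if "n \<ge> N" for n
    using Q_diff_le[OF approx_fin_supp[OF assms] fin_supp_diff[OF approx_fin_supp approx_fin_supp], OF assms assms, of N N n] N[of N n] that
    by simp
  moreover have "2 * Q (\<phi> N) (\<phi> N) + 2 > 0"
    using Q_nonneg[OF approx_fin_supp[OF assms], of N] by simp
  ultimately show ?thesis by blast
qed

text \<open>Closability: the difference \<open>w\<close> tends to 0 in l2 and is Cauchy in energy.
  For fixed \<open>n\<close> the mixed term \<open>Q (w n) (w j)\<close> is an inner product of
  \<open>w j\<close> with the fixed l2 function \<open>- lap (w n)\<close>, so it vanishes as
  \<open>j\<close> grows, and the Cauchy bound passes to \<open>Q (w n) (w n)\<close>.\<close>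

lemma approx_closable:
  assumes "approx \<phi> u" "approx \<psi> u"
  shows "(\<lambda>n. Q (\<lambda>x. \<phi> n x - \<psi> n x) (\<lambda>x. \<phi> n x - \<psi> n x)) \<longlonglongrightarrow> 0"
proof (rule LIMSEQ_I)
  define w where "w n = (\<lambda>x. \<phi> n x - \<psi> n x)" for n
  have fs: "\<phi> n \<in> fin_supp" "\<psi> n \<in> fin_supp" "w n \<in> fin_supp" for n
    using assms by (auto simp: w_def intro: fin_supp_diff approx_fin_supp)
  obtain u' where u': "u = l2_apply u'" using approx_ell2[OF assms(1)] .
  have "Abs_l2 (w n) = Abs_l2 (\<phi> n) - Abs_l2 (\<psi> n)" for n
    by (rule l2_eqI) (simp add: fin_supp_l2 fs, simp add: w_def)
  then have w0: "(\<lambda>n. Abs_l2 (w n)) \<longlonglongrightarrow> 0"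
    using tendsto_diff[OF approx_tendsto approx_tendsto, OF assms[unfolded u']] by simp
  fix e :: real assume "e > 0"
  \<comment> \<open>\<open>Q_diff_le\<close> doubles the two Cauchy bounds, so that
    \<open>e / 8\<close> for each leads to \<open>e / 2\<close>.\<close>
  then have e4: "e / 8 > 0" by simp
  obtain N M where
    N: "\<And>i j. i \<ge> N \<Longrightarrow> j \<ge> N \<Longrightarrow> Q (\<lambda>x. \<phi> i x - \<phi> j x) (\<lambda>x. \<phi> i x - \<phi> j x) < e / 8" and
    M: "\<And>i j. i \<ge> M \<Longrightarrow> j \<ge> M \<Longrightarrow> Q (\<lambda>x. \<psi> i x - \<psi> j x) (\<lambda>x. \<psi> i x - \<psi> j x) < e / 8"
    using approx_Cauchy[OF assms(1) e4] approx_Cauchy[OF assms(2) e4] by blast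
  have Cauchy: "Q (\<lambda>x. w i x - w j x) (\<lambda>x. w i x - w j x) \<le> e / 2" if "i \<ge> max N M" "j \<ge> max N M" for i j
    using Q_diff_le[OF fin_supp_diff fin_supp_diff, OF fs(1,1,2,2), of i j i j] N[of i j] M[of i j] that
    by (simp add: w_def algebra_simps)
  have "Q (w n) (w n) \<le> e / 2" if n: "n \<ge> max N M" for n
  proof (rule tendsto_lowerbound)
    show "(\<lambda>j. e / 2 + 2 * Q (w n) (w j)) \<longlonglongrightarrow> e / 2"
      using tendsto_add[OF tendsto_const[of "e / 2"] tendsto_mult_right_zero[of _ _ "-2"], OF tendsto_inner[OF tendsto_const w0, of "Abs_l2 (lap (w n))", unfolded inner_zero_right]]
      by (simp add: Q_eq_inner_Abs fs)
    have "Q (w n) (w n) \<le> e / 2 + 2 * Q (w n) (w j)" if "j \<ge> max N M" for j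
      using Cauchy[OF n that] Q_diff_diff[OF fs(3,3), of n j] Q_nonneg[OF fs(3), of j] by simp
    then show "\<forall>\<^sub>F j in sequentially. Q (w n) (w n) \<le> e / 2 + 2 * Q (w n) (w j)"
      unfolding eventually_sequentially by blast
  qed simp
  then have "\<forall>n\<ge>max N M. norm (Q (w n) (w n) - 0) < e"
    using \<open>e > 0\<close> Q_nonneg[OF fs(3)] by fastforce
  then show "\<exists>N. \<forall>n\<ge>N. norm (Q (\<lambda>x. \<phi> n x - \<psi> n x) (\<lambda>x. \<phi> n x - \<psi> n x) - 0) < e"
    unfolding w_def by blast
qed

lemma Q_tendsto_zero:
  assumes fs: "\<And>n. \<phi> n \<in> fin_supp" "\<And>n. \<psi> n \<in> fin_supp"
    and "(\<lambda>n. Q (\<phi> n) (\<phi> n)) \<longlonglongrightarrow> 0" "B > 0" "\<And>n. n \<ge> N \<Longrightarrow> Q (\<psi> n) (\<psi> n) \<le> B"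
  shows "(\<lambda>n. Q (\<phi> n) (\<psi> n)) \<longlonglongrightarrow> 0"
proof (rule LIMSEQ_I)
  fix e :: real assume "e > 0"
  then obtain d where "d > 0" and
    d: "\<And>\<phi> \<psi>. \<phi> \<in> fin_supp \<Longrightarrow> \<psi> \<in> fin_supp \<Longrightarrow> Q \<phi> \<phi> < d \<Longrightarrow> Q \<psi> \<psi> \<le> B \<Longrightarrow> \<bar>Q \<phi> \<psi>\<bar> < e"
    using Q_small[OF \<open>B > 0\<close> \<open>e > 0\<close>] by blast
  obtain M where "\<And>n. n \<ge> M \<Longrightarrow> norm (Q (\<phi> n) (\<phi> n) - 0) < d"
    using LIMSEQ_D[OF assms(3) \<open>d > 0\<close>] by blast
  then have "\<forall>n\<ge>max M N. norm (Q (\<phi> n) (\<psi> n) - 0) < e"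
    using d[OF fs] assms(5) by fastforce
  then show "\<exists>N. \<forall>n\<ge>N. norm (Q (\<phi> n) (\<psi> n) - 0) < e" by blast
qed

lemma approx_Q_convergent:
  assumes "approx \<phi> u" "approx \<psi> v"
  shows "convergent (\<lambda>n. Q (\<phi> n) (\<psi> n))"
proof -
  note fs = approx_fin_supp[OF assms(1)] approx_fin_supp[OF assms(2)]
  obtain B M B' M' where B: "B > 0" "\<And>n. n \<ge> M \<Longrightarrow> Q (\<phi> n) (\<phi> n) \<le> B" 
    and B': "B' > 0" "\<And>n. n \<ge> M' \<Longrightarrow> Q (\<psi> n) (\<psi> n) \<le> B'"
    using approx_Q_bounded[OF assms(1)] approx_Q_bounded[OF assms(2)] by blast
  have "Cauchy (\<lambda>n. Q (\<phi> n) (\<psi> n))"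
  proof (rule CauchyI)
    fix e :: real assume "e > 0"
    then have e: "e / 2 > 0" by simp
    obtain d where d: "d > 0" 
      "\<And>\<phi> \<psi>. \<phi> \<in> fin_supp \<Longrightarrow> \<psi> \<in> fin_supp \<Longrightarrow> Q \<phi> \<phi> < d \<Longrightarrow> Q \<psi> \<psi> \<le> B' \<Longrightarrow> \<bar>Q \<phi> \<psi>\<bar> < e / 2"
      using Q_small[OF B'(1) e] by blast
    obtain d' where d': "d' > 0" 
      "\<And>\<phi> \<psi>. \<phi> \<in> fin_supp \<Longrightarrow> \<psi> \<in> fin_supp \<Longrightarrow> Q \<phi> \<phi> < d' \<Longrightarrow> Q \<psi> \<psi> \<le> B \<Longrightarrow> \<bar>Q \<phi> \<psi>\<bar> < e / 2"
      using Q_small[OF B(1) e] by blast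
    obtain N where N: "\<And>i j. i \<ge> N \<Longrightarrow> j \<ge> N \<Longrightarrow> Q (\<lambda>x. \<phi> i x - \<phi> j x) (\<lambda>x. \<phi> i x - \<phi> j x) < d"
      using approx_Cauchy[OF assms(1) d(1)] by blast
    obtain N' where N': "\<And>i j. i \<ge> N' \<Longrightarrow> j \<ge> N' \<Longrightarrow> Q (\<lambda>x. \<psi> i x - \<psi> j x) (\<lambda>x. \<psi> i x - \<psi> j x) < d'"
      using approx_Cauchy[OF assms(2) d'(1)] by blast
    define L where "L = Max {M, M', N, N'}"
    have L: "M \<le> L" "M' \<le> L" "N \<le> L" "N' \<le> L" by (auto simp: L_def)
    have "norm (Q (\<phi> i) (\<psi> i) - Q (\<phi> j) (\<psi> j)) < e" if "i \<ge> L" "j \<ge> L" for i j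
    proof -
      have "\<bar>Q (\<lambda>x. \<phi> i x - \<phi> j x) (\<psi> i)\<bar> < e / 2"
        by (rule d) (use that L N[of i j] B'(2)[of i] in \<open>auto intro: fin_supp_diff fs\<close>)
      moreover have "\<bar>Q (\<lambda>x. \<psi> i x - \<psi> j x) (\<phi> j)\<bar> < e / 2"
        by (rule d') (use that L N'[of i j] B(2)[of j] in \<open>auto intro: fin_supp_diff fs\<close>)
      moreover have "Q (\<phi> i) (\<psi> i) - Q (\<phi> j) (\<psi> j)
          = Q (\<lambda>x. \<phi> i x - \<phi> j x) (\<psi> i) + Q (\<lambda>x. \<psi> i x - \<psi> j x) (\<phi> j)"
        by (simp add: Q_diff_left fs Q_commute[OF fs(2), of _ "\<phi> j"])
      ultimately show ?thesis by simp
    qed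
    then show "\<exists>L. \<forall>i\<ge>L. \<forall>j\<ge>L. norm (Q (\<phi> i) (\<psi> i) - Q (\<phi> j) (\<psi> j)) < e" by blast
  qed
  then show ?thesis by (simp add: Cauchy_convergent_iff)
qed

text \<open>Two approximations of the same function differ by a sequence whose energy tends to 0, so
  the limit does not depend on the choice. This makes the definite description in
  \<open>closed_form\<close> denote that limit.\<close>

lemma closed_form_tendsto:
  assumes "approx \<phi> u" "approx \<psi> v"
  shows "(\<lambda>n. Q (\<phi> n) (\<psi> n)) \<longlonglongrightarrow> closed_form b (\<lambda>_. 1) u v"
proof -
  obtain c where c: "(\<lambda>n. Q (\<phi> n) (\<psi> n)) \<longlonglongrightarrow> c"
    using approx_Q_convergent[OF assms] by (auto simp: convergent_def)
  have "(\<lambda>n. Q (\<phi>' n) (\<psi>' n)) \<longlonglongrightarrow> c" if *: "approx \<phi>' u" "approx \<psi>' v" for \<phi>' \<psi>'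
  proof -
    note fs = approx_fin_supp[OF assms(1)] approx_fin_supp[OF assms(2)]
      approx_fin_supp[OF *(1)] approx_fin_supp[OF *(2)]
    obtain B N B' N' where B: "B > 0" "\<And>n. n \<ge> N \<Longrightarrow> Q (\<phi> n) (\<phi> n) \<le> B" 
      and B': "B' > 0" "\<And>n. n \<ge> N' \<Longrightarrow> Q (\<psi>' n) (\<psi>' n) \<le> B'"
      using approx_Q_bounded[OF assms(1)] approx_Q_bounded[OF *(2)] by blast
    have "(\<lambda>n. Q (\<lambda>x. \<phi>' n x - \<phi> n x) (\<psi>' n)) \<longlonglongrightarrow> 0"
      by (rule Q_tendsto_zero[OF _ _ approx_closable[OF *(1) assms(1)] B'])
        (auto intro: fin_supp_diff fs)
    moreover have "(\<lambda>n. Q (\<lambda>x. \<psi>' n x - \<psi> n x) (\<phi> n)) \<longlonglongrightarrow> 0"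
      by (rule Q_tendsto_zero[OF _ _ approx_closable[OF *(2) assms(2)] B])
        (auto intro: fin_supp_diff fs)
    moreover have "Q (\<phi>' n) (\<psi>' n)
        = Q (\<lambda>x. \<phi>' n x - \<phi> n x) (\<psi>' n) + Q (\<lambda>x. \<psi>' n x - \<psi> n x) (\<phi> n) + Q (\<phi> n) (\<psi> n)" for n
      by (simp add: Q_diff_left fs Q_commute[OF fs(2), of _ "\<phi> n"] Q_commute[OF fs(4), of _ "\<phi> n"])
    ultimately show ?thesis
      using tendsto_add[OF tendsto_add c] by fastforce
  qed
  then have "closed_form b (\<lambda>_. 1) u v = c"
    unfolding closed_form_def using assms
    by (intro the_equality) (blast, meson LIMSEQ_unique c)
  with c show ?thesis by simp
qed

section \<open>The action and the energy of the Friedrichs operator\<close>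

lemma approx_const: "f \<in> fin_supp \<Longrightarrow> approx (\<lambda>_. f) f"
  using l2_apply_in_ell2[of "Abs_l2 f"]
  by (auto simp: form_approx_def fin_supp_l2 Q_eq_infsum ell2_norm_def ell2_inner_def)

text \<open>This supplies initial data in the domain. Along the constant approximation of
  \<open>f\<close>, the form is an inner product with \<open>- lap f\<close>, which is continuous in
  l2.\<close>

lemma friedrichs_fin_supp:
  assumes f: "f \<in> fin_supp"
  shows "friedrichs b (\<lambda>_. 1) f (\<lambda>x. - lap f x)"
  unfolding friedrichs_def
proof (intro conjI ballI)
  define h where "h = - Abs_l2 (lap f)"
  have h: "(\<lambda>x. - lap f x) = l2_apply h"
    by (auto simp: h_def fin_supp_l2 lap_fin_supp f)
  show "f \<in> form_domain b (\<lambda>_. 1)" using approx_const[OF f] by (auto simp: form_domain_def)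
  show "(\<lambda>x. - lap f x) \<in> ell2 (\<lambda>_. 1)" by (simp add: h)
  fix v assume "v \<in> form_domain b (\<lambda>_. 1)"
  then obtain \<psi> where \<psi>: "approx \<psi> v" by (auto simp: form_domain_def)
  obtain v' where v': "v = l2_apply v'" using approx_ell2[OF \<psi>] .
  have "(\<lambda>n. h \<bullet> Abs_l2 (\<psi> n)) \<longlonglongrightarrow> h \<bullet> v'"
    by (intro tendsto_intros approx_tendsto \<psi>[unfolded v'])
  then have "(\<lambda>n. Q f (\<psi> n)) \<longlonglongrightarrow> h \<bullet> v'"
    by (simp add: Q_eq_inner_Abs f approx_fin_supp[OF \<psi>] h_def)
  then show "closed_form b (\<lambda>_. 1) f v = ell2_inner (\<lambda>_. 1) (\<lambda>x. - lap f x) v"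
    using LIMSEQ_unique[OF closed_form_tendsto[OF approx_const[OF f] \<psi>]]
    by (simp add: h v' ell2_inner_l2)
qed

text \<open>The defining identity is tested with the indicator of \<open>x\<close>. By local
  finiteness \<open>lap\<close> at \<open>x\<close> involves finitely many values, so it passes to
  the pointwise limit of an approximation.\<close>

lemma friedrichs_eq_lap:
  assumes "friedrichs b (\<lambda>_. 1) u h"
  shows "h x = - lap u x"
proof -
  obtain \<phi> where \<phi>: "approx \<phi> u"
    using assms by (auto simp: friedrichs_def form_domain_def)
  have ind: "indicator {x} \<in> fin_supp" by (simp add: fin_supp_indicator)
  have infsum_ind: "(\<Sum>\<^sub>\<infinity>y. indicator {x} y * g y) = g x" for g :: "'a \<Rightarrow> real"
    using infsum_cong_neutral[of "{x}" UNIV g "\<lambda>y. indicator {x} y * g y"] by simp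
  have "Q (\<phi> n) (indicator {x}) = - lap (\<phi> n) x" for n
    by (simp add: Q_eq_infsum mult.commute[of _ "indicator _ _"] infsum_ind)
  moreover have "(\<lambda>n. - lap (\<phi> n) x) \<longlonglongrightarrow> - lap u x"
    unfolding lap_eq by (intro tendsto_intros approx_tendsto_pointwise[OF \<phi>])
  ultimately have "closed_form b (\<lambda>_. 1) u (indicator {x}) = - lap u x"
    using LIMSEQ_unique[OF closed_form_tendsto[OF \<phi> approx_const[OF ind]]] by simp
  moreover have "closed_form b (\<lambda>_. 1) u (indicator {x}) = ell2_inner (\<lambda>_. 1) h (indicator {x})"
    using assms approx_const[OF ind] by (auto simp: friedrichs_def form_domain_def)
  ultimately show ?thesis
    by (simp add: ell2_inner_def mult.commute[of _ "indicator _ _"] infsum_ind)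
qed

text \<open>The defining identity is tested with \<open>u\<close> itself; the bound for
  approximations passes to the limit over a finite \<open>A\<close>. It gives finite energy, and
  with \<open>A\<close> empty it gives positivity of the operator.\<close>

lemma friedrichs_sum_Gamma_le:
  assumes "friedrichs b (\<lambda>_. 1) u h" "finite A"
  shows "(\<Sum>x\<in>A. Gamma u u x) \<le> ell2_inner (\<lambda>_. 1) h u"
proof -
  obtain \<phi> where \<phi>: "approx \<phi> u"
    using assms by (auto simp: friedrichs_def form_domain_def)
  have "(\<lambda>n. Q (\<phi> n) (\<phi> n)) \<longlonglongrightarrow> ell2_inner (\<lambda>_. 1) h u"
    using closed_form_tendsto[OF \<phi> \<phi>] assms by (auto simp: friedrichs_def)
  moreover have "(\<lambda>n. \<Sum>x\<in>A. Gamma (\<phi> n) (\<phi> n) x) \<longlonglongrightarrow> (\<Sum>x\<in>A. Gamma u u x)"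
    unfolding Gamma_def by (intro tendsto_intros approx_tendsto_pointwise[OF \<phi>]) auto
  ultimately show ?thesis
    using sum_Gamma_le_Q[OF approx_fin_supp[OF \<phi>] assms(2)] by (blast intro: LIMSEQ_le)
qed

end

subsection \<open>The gradient estimate\<close>

text \<open>Markov's inequality for counting measure: it turns a finite total into vanishing at
  infinity.\<close>

lemma finite_superlevel:
  fixes f :: "'a \<Rightarrow> real"
  assumes "\<And>A. finite A \<Longrightarrow> sum f A \<le> C" "e > 0"
  shows "finite {x. f x \<ge> e}"
proof (rule ccontr)
  assume inf: "infinite {x. f x \<ge> e}"
  obtain n where n: "C / e < real n" using reals_Archimedean2 by blast
  obtain A where A: "A \<subseteq> {x. f x \<ge> e}" "finite A" "card A = n"
    using infinite_arbitrarily_large[OF inf] by blast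
  have "real n * e \<le> sum f A"
    using sum_mono[of A "\<lambda>_. e" f] A by auto
  with assms(1)[OF A(2)] n \<open>e > 0\<close> show False by (simp add: divide_less_eq)
qed

context unit_measure_graph
begin

section \<open>Inequalities for the carre du champ\<close>

lemma Gamma_le_twice:
  "Gamma f f x \<le> 2 * Gamma g g x + 2 * Gamma (\<lambda>y. f y - g y) (\<lambda>y. f y - g y) x"
proof -
  have "(\<Sum>y\<in>nbrs x. b x y * (f y - f x) * (f y - f x))
    \<le> (\<Sum>y\<in>nbrs x. 2 * (b x y * (g y - g x) * (g y - g x))
       + 2 * (b x y * (f y - g y - (f x - g x)) * (f y - g y - (f x - g x))))"
  proof (rule sum_mono)
    fix y
    have "(f y - f x)\<^sup>2 \<le> 2 * (g y - g x)\<^sup>2 + 2 * (f y - g y - (f x - g x))\<^sup>2"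
      using zero_le_power2[of "(g y - g x) - (f y - g y - (f x - g x))"]
      by (simp add: power2_eq_square algebra_simps)
    from mult_left_mono[OF this weight_nonneg[of x y]]
    show "b x y * (f y - f x) * (f y - f x) \<le> 2 * (b x y * (g y - g x) * (g y - g x))
       + 2 * (b x y * (f y - g y - (f x - g x)) * (f y - g y - (f x - g x)))"
      by (simp add: power2_eq_square distrib_left mult.assoc mult.left_commute)
  qed
  then show ?thesis
    unfolding Gamma_def sum.distrib sum_distrib_left[symmetric] by linarith
qed

lemma edge_le_Gamma: "b x y * (f y - f x)\<^sup>2 \<le> 2 * Gamma f f x"
proof (cases "0 < b x y")
  case True
  then have "b x y * (f y - f x)\<^sup>2 \<le> (\<Sum>y\<in>nbrs x. b x y * (f y - f x)\<^sup>2)"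
    by (intro member_le_sum) auto
  then show ?thesis by (simp add: Gamma_def power2_eq_square mult.assoc)
next
  case False
  then show ?thesis by (simp add: not_less)
qed

text \<open>Cauchy-Schwarz with each weight split into two square roots. It turns gradient decay
  into decay of the time derivative of the flow.\<close>

lemma lap_square_le_Gamma: "(lap f x)\<^sup>2 \<le> 2 * (\<Sum>y\<in>nbrs x. b x y) * Gamma f f x"
proof -
  have "lap f x = (\<Sum>y\<in>nbrs x. sqrt (b x y) * (sqrt (b x y) * (f y - f x)))"
    by (simp add: lap_eq mult.assoc[symmetric])
  also have "\<dots>\<^sup>2 \<le> (\<Sum>y\<in>nbrs x. (sqrt (b x y))\<^sup>2) * (\<Sum>y\<in>nbrs x. (sqrt (b x y) * (f y - f x))\<^sup>2)"
    by (rule Cauchy_Schwarz_ineq_sum)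
  also have "\<dots> = 2 * (\<Sum>y\<in>nbrs x. b x y) * Gamma f f x"
    by (simp add: Gamma_def power_mult_distrib) (simp add: power2_eq_square mult.assoc)
  finally show ?thesis .
qed

text \<open>The curvature condition in Bochner form, as it enters the comparison of
  \<open>lap F\<close> with the time derivative of \<open>F\<close>.\<close>

lemma CD_infinity_lap:
  assumes "CD_infinity b (\<lambda>_. 1) K"
  shows "2 * K * Gamma f f x \<le> lap (Gamma f f) x - 2 * Gamma f (lap f) x"
proof -
  have G: "Gamma_op b (\<lambda>_. 1) (Suc 0) = Gamma"
    using Gamma_op_1 by (intro ext) simp
  have "Gamma (lap f) f x = Gamma f (lap f) x"
    unfolding Gamma_def by (intro arg_cong2[where f = "(/)"] sum.cong) auto
  moreover have "Gamma_op b (\<lambda>_. 1) 2 f f x \<ge> K * Gamma_op b (\<lambda>_. 1) 1 f f x"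
    using assms by (simp add: CD_infinity_def)
  ultimately show ?thesis
    unfolding numeral_2_eq_2 One_nat_def Gamma_op.simps(2)[of b _ "Suc 0"] G by simp
qed

end

text \<open>The semigroup is generated by minus the Friedrichs operator, whence the sign in front of
  \<open>g\<close>.\<close>

locale unit_measure_heat = unit_measure_graph b + c0_semigroup T
  for b :: "'a \<Rightarrow> 'a \<Rightarrow> real" and T :: "real \<Rightarrow> 'a l2 \<Rightarrow> 'a l2" +
  assumes gen_iff: "gen u g \<longleftrightarrow> friedrichs b (\<lambda>_. 1) (l2_apply u) (\<lambda>x. - l2_apply g x)"
begin

section \<open>Energy and decay in space along the flow\<close>

lemma gen_lap: "gen u g \<Longrightarrow> lap (l2_apply u) = l2_apply g"
  using friedrichs_eq_lap[of "l2_apply u"] unfolding gen_iff by fastforce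

lemma gen_sum_Gamma_le:
  assumes "gen u g" "finite A"
  shows "(\<Sum>x\<in>A. Gamma (l2_apply u) (l2_apply u) x) \<le> - (g \<bullet> u)"
proof -
  have "(\<lambda>x. - l2_apply g x) = l2_apply (- g)" by auto
  then show ?thesis
    using friedrichs_sum_Gamma_le[OF assms(1)[unfolded gen_iff] assms(2)] ell2_inner_l2[of "- g" u]
    by simp
qed

lemma gen_fin_supp: "f \<in> fin_supp \<Longrightarrow> gen (Abs_l2 f) (Abs_l2 (lap f))"
  by (simp add: gen_iff fin_supp_l2 lap_fin_supp friedrichs_fin_supp)

lemma DERIV_T_apply:
  assumes "gen u g" "t > 0"
  shows "((\<lambda>t. l2_apply (T t u) x) has_real_derivative l2_apply (T t g) x) (at t)"
  using bounded_linear.has_vector_derivative[OF bounded_linear_l2_apply has_vector_derivative_T[OF assms]]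
  by (simp add: has_real_derivative_iff_has_vector_derivative)

lemma continuous_on_T_apply: "continuous_on {0..} (\<lambda>t. l2_apply (T t u) x)"
  by (intro bounded_linear.continuous_on[OF bounded_linear_l2_apply] continuous_on_T)

text \<open>The derivative of the squared norm is twice the inner product of \<open>T s g\<close>
  and \<open>T s u\<close>, which is nonpositive by the energy bound over the empty set.\<close>

lemma norm_T_le:
  assumes "gen u g" "t \<ge> 0"
  shows "norm (T t u) \<le> norm u"
proof -
  have "(norm (T t u))\<^sup>2 \<le> (norm (T 0 u))\<^sup>2"
    unfolding power2_norm_eq_inner
  proof (rule DERIV_nonpos_imp_decreasing_open[OF assms(2)])
    fix s :: real assume s: "0 < s" "s < t"
    note d = has_vector_derivative_T[OF assms(1) s(1), unfolded has_vector_derivative_def]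
    have "((\<lambda>t. T t u \<bullet> T t u) has_real_derivative 2 * (T s g \<bullet> T s u)) (at s)"
      using has_derivative_inner[OF d d] unfolding has_field_derivative_def
      by (rule has_derivative_eq_rhs) (auto simp: inner_commute)
    moreover have "T s g \<bullet> T s u \<le> 0"
      using gen_sum_Gamma_le[OF gen_T[OF assms(1), of s], of "{}"] s by simp
    ultimately show "\<exists>y. ((\<lambda>t. T t u \<bullet> T t u) has_real_derivative y) (at s) \<and> y \<le> 0" by auto
  next
    show "continuous_on {0..t} (\<lambda>t. T t u \<bullet> T t u)"
      by (intro continuous_intros continuous_on_subset[OF continuous_on_T]) auto
  qed
  then show ?thesis by (simp add: T_0)
qed

text \<open>At a single time the superlevel sets are finite, since energy and norm are. The energy
  of \<open>T t u - T s u\<close> is at most the product of the norms of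
  \<open>T t g - T s g\<close> and \<open>T t u - T s u\<close>, so continuity of both orbits
  extends the estimate to nearby times, and compactness leaves finitely many times.\<close>

lemma Gamma_T_vanishes_at_infinity:
  assumes gen: "gen u g" and "e > 0"
  shows "\<exists>A. finite A \<and> (\<forall>t\<in>{0..S}. \<forall>x. x \<notin> A \<longrightarrow>
           Gamma (l2_apply (T t u)) (l2_apply (T t u)) x + (l2_apply (T t u) x)\<^sup>2 < e)"
proof -
  define F where "F v x = Gamma (l2_apply v) (l2_apply v) x + (l2_apply v x)\<^sup>2" for v x
  \<comment> \<open>Chosen so that \<open>F\<close> at a nearby time is at most
    \<open>2 * (e / 8) + 4 * r * r\<close>, which is \<open>e / 2\<close>.\<close>
  define r where "r = sqrt (e / 16)"
  have r: "r > 0" "r * r = e / 16" using \<open>e > 0\<close> by (auto simp: r_def)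
  have unif: "\<exists>d>0. \<forall>s\<in>{0..S}. \<forall>t\<in>{0..S}. dist t s < d \<longrightarrow> dist (T t w) (T s w) < r" for w
    using compact_uniformly_continuous[OF continuous_on_subset[OF continuous_on_T], of "{0..S}" w] r(1)
    by (auto simp: uniformly_continuous_on_def)
  obtain d1 d2 where d: "d1 > 0" "d2 > 0"
    and d1: "\<And>s t. s \<in> {0..S} \<Longrightarrow> t \<in> {0..S} \<Longrightarrow> dist t s < d1 \<Longrightarrow> dist (T t u) (T s u) < r"
    and d2: "\<And>s t. s \<in> {0..S} \<Longrightarrow> t \<in> {0..S} \<Longrightarrow> dist t s < d2 \<Longrightarrow> dist (T t g) (T s g) < r"
    using unif[of u] unif[of g] by metis
  define d where "d = min d1 d2"
  have near: "F (T t u) x < e" if "s \<in> {0..S}" "t \<in> {0..S}" "dist t s < d" "F (T s u) x < e / 8" for s t x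
  proof -
    define v where "v = T t u - T s u"
    have v: "norm v < r" and w: "norm (T t g - T s g) < r"
      using that d1[of s t] d2[of s t] by (auto simp: d_def v_def dist_norm)
    have genv: "gen v (T t g - T s g)"
      unfolding v_def using that by (intro gen_diff gen_T gen) auto
    have "Gamma (l2_apply v) (l2_apply v) x \<le> - ((T t g - T s g) \<bullet> v)"
      using gen_sum_Gamma_le[OF genv, of "{x}"] by simp
    also have "\<dots> \<le> norm (T t g - T s g) * norm v"
      using Cauchy_Schwarz_ineq2[of "T t g - T s g" v] by simp
    also have "\<dots> \<le> r * r"
      using v w r(1) by (intro mult_mono) auto
    finally have G: "Gamma (l2_apply v) (l2_apply v) x \<le> e / 16" by (simp add: r)
    have "(l2_apply v x)\<^sup>2 \<le> (norm v)\<^sup>2" by (rule l2_apply_square_le_norm)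
    also have "\<dots> \<le> r * r" using v r(1) by (auto simp: power2_eq_square intro!: mult_mono)
    finally have V: "(l2_apply v x)\<^sup>2 \<le> e / 16" by (simp add: r)
    have "(l2_apply (T t u) x)\<^sup>2 \<le> 2 * (l2_apply (T s u) x)\<^sup>2 + 2 * (l2_apply v x)\<^sup>2"
      using zero_le_power2[of "l2_apply (T s u) x - l2_apply v x"]
      by (simp add: v_def power2_eq_square algebra_simps)
    moreover have "Gamma (l2_apply (T t u)) (l2_apply (T t u)) x
        \<le> 2 * Gamma (l2_apply (T s u)) (l2_apply (T s u)) x + 2 * Gamma (l2_apply v) (l2_apply v) x"
      using Gamma_le_twice[of "l2_apply (T t u)" x "l2_apply (T s u)"]
      by (simp add: v_def minus_l2.rep_eq[abs_def])
    ultimately have "F (T t u) x \<le> 2 * F (T s u) x + 4 * (e / 16)"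
      using G V by (simp add: F_def)
    then show ?thesis using that(4) \<open>e > 0\<close> by simp
  qed
  have fin: "finite {x. F (T s u) x \<ge> e / 8}" if "s \<in> {0..S}" for s
  proof (rule finite_superlevel)
    fix A :: "'a set" assume "finite A"
    then show "sum (F (T s u)) A \<le> - (T s g \<bullet> T s u) + (norm (T s u))\<^sup>2"
      unfolding F_def sum.distrib using that
      by (intro add_mono gen_sum_Gamma_le gen_T gen sum_square_le_norm_l2) auto
  qed (use \<open>e > 0\<close> in simp)
  have cover: "{0..S} \<subseteq> (\<Union>s\<in>{0..S}. ball s d)"
    using d by (auto simp: d_def)
  obtain D where D: "D \<subseteq> {0..S}" "finite D" "{0..S} \<subseteq> (\<Union>s\<in>D. ball s d)"
    by (rule compactE_image[OF _ _ cover]) auto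
  have "F (T t u) x < e" if "t \<in> {0..S}" "x \<notin> (\<Union>s\<in>D. {x. F (T s u) x \<ge> e / 8})" for t x
  proof -
    obtain s where "s \<in> D" "dist t s < d" using D(3) \<open>t \<in> {0..S}\<close> by (auto simp: dist_commute)
    then show ?thesis using near[of s t x] that D(1) by (auto simp: subset_iff not_le)
  qed
  moreover have "finite (\<Union>s\<in>D. {x. F (T s u) x \<ge> e / 8})"
    using D fin by auto
  ultimately show ?thesis unfolding F_def by blast
qed

text \<open>Maximum principle with the penalty \<open>- e * t\<close>. If the bound failed, the
  penalised function would attain a maximum at some positive time \<open>s\<close> and vertex
  \<open>z\<close>, where \<open>lap (F s) z \<le> 0\<close>. Curvature bounds the time derivative
  of \<open>F\<close> by \<open>lap F\<close>, so the penalised function would be strictly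
  decreasing in time there, hence larger just before.\<close>

lemma gradient_estimate:
  assumes gen: "gen u g" and CD: "CD_infinity b (\<lambda>_. 1) K" and "K > 0"
    and bound: "\<And>x. (l2_apply u x)\<^sup>2 \<le> c" and "c \<ge> 0" and "t0 \<ge> 0"
  shows "(exp (2 * K * t0) - 1) / K * Gamma (l2_apply (T t0 u)) (l2_apply (T t0 u)) x0
           + (l2_apply (T t0 u) x0)\<^sup>2 \<le> c"
proof (rule ccontr)
  define a where "a t = (exp (2 * K * t) - 1) / K" for t
  define f where "f t = l2_apply (T t u)" for t
  define F where "F t x = a t * Gamma (f t) (f t) x + (f t x)\<^sup>2" for t x
  have a_nonneg: "a t \<ge> 0" if "t \<ge> 0" for t using that \<open>K > 0\<close> by (simp add: a_def)
  have a_mono: "a s \<le> a t" if "s \<le> t" for s t 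
    using that \<open>K > 0\<close> by (simp add: a_def divide_le_cancel)
  assume "\<not> ?thesis"
  then have gt: "F t0 x0 > c" by (simp add: F_def a_def f_def)
  have F0: "F 0 x \<le> c" for x using bound[of x] by (simp add: F_def a_def f_def T_0)
  \<comment> \<open>With \<open>t0 + 1\<close> in the denominator the division is valid even for
    \<open>t0 = 0\<close>, and the penalised value \<open>m\<close> at \<open>(t0, x0)\<close> still
    exceeds \<open>c\<close>.\<close>
  define e where "e = (F t0 x0 - c) / (t0 + 1)"
  have "e > 0" using gt \<open>t0 \<ge> 0\<close> by (simp add: e_def)
  have "e * (t0 + 1) = F t0 x0 - c"
    using \<open>t0 \<ge> 0\<close> by (simp add: e_def)
  then have "e * t0 < F t0 x0 - c"
    using \<open>e > 0\<close> by (simp add: distrib_left)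
  define m where "m = F t0 x0 - e * t0"
  have m: "m > c" using \<open>e * t0 < F t0 x0 - c\<close> by (simp add: m_def)
  \<comment> \<open>\<open>F\<close> is at most \<open>a t0 + 1\<close> times the quantity that
    vanishes at infinity; below \<open>q\<close> this is less than \<open>m\<close>, so only the
    finite set \<open>A\<close> can carry the maximum.\<close>
  define q where "q = m / (a t0 + 1)"
  have q: "q > 0" using m \<open>c \<ge> 0\<close> a_nonneg[OF \<open>t0 \<ge> 0\<close>] by (simp add: q_def)
  obtain A where "finite A" and A: "\<And>t x. t \<in> {0..t0} \<Longrightarrow> x \<notin> A \<Longrightarrow> Gamma (f t) (f t) x + (f t x)\<^sup>2 < q"
    using Gamma_T_vanishes_at_infinity[OF gen q, of t0] unfolding f_def by blast
  have small: "F t x < m" if "t \<in> {0..t0}" "x \<notin> A" for t x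
  proof -
    have "F t x \<le> (a t0 + 1) * (Gamma (f t) (f t) x + (f t x)\<^sup>2)"
      unfolding F_def distrib_left
      using that a_nonneg[of t] a_nonneg[OF \<open>t0 \<ge> 0\<close>] a_mono[of t t0]
      by (intro add_mono mult_right_mono) (auto simp: distrib_right)
    also have "\<dots> < (a t0 + 1) * q"
      using A[OF that] a_nonneg[OF \<open>t0 \<ge> 0\<close>] by simp
    also have "\<dots> = m" using a_nonneg[OF \<open>t0 \<ge> 0\<close>] by (simp add: q_def)
    finally show ?thesis .
  qed
  have "x0 \<in> A"
  proof (rule ccontr)
    assume "x0 \<notin> A"
    then have "F t0 x0 < m" using small[of t0 x0] \<open>t0 \<ge> 0\<close> by simp
    then show False using \<open>e > 0\<close> \<open>t0 \<ge> 0\<close> by (auto simp: m_def mult_less_0_iff)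
  qed
  have cont: "continuous_on {0..t0} (\<lambda>t. F t x - e * t)" for x
    unfolding F_def Gamma_def a_def f_def
    by (intro continuous_intros continuous_on_subset[OF continuous_on_T_apply]) (use \<open>K > 0\<close> in auto)
  \<comment> \<open>The maximum is taken over time first, for each vertex by compactness, and then
    over the finitely many vertices of \<open>A\<close>.\<close>
  have "\<exists>s\<in>{0..t0}. \<forall>t\<in>{0..t0}. F t x - e * t \<le> F s x - e * s" for x
    by (rule continuous_attains_sup[OF _ _ cont]) (use \<open>t0 \<ge> 0\<close> in auto)
  then obtain \<tau> where \<tau>: "\<And>x. \<tau> x \<in> {0..t0}"
    and \<tau>_max: "\<And>x t. t \<in> {0..t0} \<Longrightarrow> F t x - e * t \<le> F (\<tau> x) x - e * \<tau> x"
    by metis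
  define M where "M = Max ((\<lambda>x. F (\<tau> x) x - e * \<tau> x) ` A)"
  have "M \<in> (\<lambda>x. F (\<tau> x) x - e * \<tau> x) ` A"
    unfolding M_def using \<open>finite A\<close> \<open>x0 \<in> A\<close> by (intro Max_in) auto
  then obtain z where z: "z \<in> A" "M = F (\<tau> z) z - e * \<tau> z" by blast
  have M_max: "F t x - e * t \<le> M" if "t \<in> {0..t0}" "x \<in> A" for t x
    unfolding M_def using that \<open>finite A\<close> by (intro order_trans[OF \<tau>_max Max_ge]) auto
  define s where "s = \<tau> z"
  have s: "s \<in> {0..t0}" "M = F s z - e * s" using \<tau> z by (auto simp: s_def)
  have "m \<le> M" unfolding m_def by (rule M_max) (use \<open>x0 \<in> A\<close> \<open>t0 \<ge> 0\<close> in auto)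
  \<comment> \<open>As \<open>a 0 = 0\<close>, the initial value of \<open>F\<close> is the square
    of the initial function, at most \<open>c\<close>, while the maximum is at least
    \<open>m > c\<close>.\<close>
  have "s \<noteq> 0" using s(2) F0[of z] m \<open>m \<le> M\<close> by auto
  with s have "s > 0" by auto
  have space_max: "F s y \<le> F s z" for y
  proof (cases "y \<in> A")
    case True
    then show ?thesis using M_max[OF s(1), of y] s(2) by simp
  next
    case False
    have "F s y < m" by (rule small[OF s(1) False])
    moreover have "e * s \<ge> 0" using \<open>e > 0\<close> \<open>s > 0\<close> by simp
    ultimately show ?thesis using \<open>m \<le> M\<close> s(2) by simp
  qed
  have lap_F: "lap (F s) z \<le> 0"
    unfolding lap_eq using space_max by (intro sum_nonpos mult_nonneg_nonpos) auto
  have lap_f: "lap (f s) = l2_apply (T s g)"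
    unfolding f_def using gen_lap[OF gen_T[OF gen, of s]] \<open>s > 0\<close> by simp
  have df: "((\<lambda>t. f t y) has_real_derivative lap (f s) y) (at s)" for y
    unfolding lap_f unfolding f_def by (rule DERIV_T_apply[OF gen \<open>s > 0\<close>])
  \<comment> \<open>This equation is what \<open>a\<close> is made for: \<open>2 * K * a\<close>
    absorbs the curvature term, and 2 absorbs the \<open>Gamma\<close> term in the Laplacian of the
    square.\<close>
  have da: "(a has_real_derivative 2 * K * a s + 2) (at s)"
    unfolding a_def[abs_def] using \<open>K > 0\<close>
    by (auto intro!: derivative_eq_intros simp: field_simps)
  have dG: "((\<lambda>t. Gamma (f t) (f t) z) has_real_derivative 2 * Gamma (f s) (lap (f s)) z) (at s)"
  proof -
    have "((\<lambda>t. b z y * (f t y - f t z) * (f t y - f t z)) has_real_derivative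
        2 * (b z y * (f s y - f s z) * (lap (f s) y - lap (f s) z))) (at s)" for y
      by (rule derivative_eq_intros df refl)+ (simp add: algebra_simps)
    then have "((\<lambda>t. \<Sum>y\<in>nbrs z. b z y * (f t y - f t z) * (f t y - f t z)) has_real_derivative
        (\<Sum>y\<in>nbrs z. 2 * (b z y * (f s y - f s z) * (lap (f s) y - lap (f s) z)))) (at s)"
      by (intro DERIV_sum)
    from DERIV_cdivide[OF this, of 2] show ?thesis
      by (simp add: Gamma_def sum_distrib_left[symmetric])
  qed
  have dF: "((\<lambda>t. F t z - e * t) has_real_derivative
      (2 * K * a s + 2) * Gamma (f s) (f s) z + a s * (2 * Gamma (f s) (lap (f s)) z)
        + 2 * f s z * lap (f s) z - e) (at s)"
    unfolding F_def by (rule derivative_eq_intros da dG df refl)+ (simp add: algebra_simps)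
  have "F s = (\<lambda>y. a s * Gamma (f s) (f s) y + 1 * (f s y)\<^sup>2)"
    by (auto simp: F_def)
  then have "lap (F s) z = a s * lap (Gamma (f s) (f s)) z + 1 * lap (\<lambda>y. (f s y)\<^sup>2) z"
    by (simp only: lap_lincomb)
  also have "\<dots> \<ge> a s * (2 * K * Gamma (f s) (f s) z + 2 * Gamma (f s) (lap (f s)) z)
      + (2 * Gamma (f s) (f s) z + 2 * f s z * lap (f s) z)"
    using CD_infinity_lap[OF CD, of "f s" z] a_nonneg[of s] \<open>s > 0\<close>
    by (intro add_mono mult_left_mono) (auto simp: lap_square)
  finally have neg: "(2 * K * a s + 2) * Gamma (f s) (f s) z + a s * (2 * Gamma (f s) (lap (f s)) z)
        + 2 * f s z * lap (f s) z - e < 0"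
    using lap_F \<open>e > 0\<close> by (simp add: algebra_simps)
  \<comment> \<open>Only earlier times are compared with \<open>s\<close>, so the case
    \<open>s = t0\<close> is covered too.\<close>
  obtain \<delta> where "\<delta> > 0" and \<delta>: "\<And>h. h > 0 \<Longrightarrow> h < \<delta> \<Longrightarrow> F s z - e * s < F (s - h) z - e * (s - h)"
    using DERIV_neg_dec_left[OF dF neg] by blast
  define h where "h = min (\<delta> / 2) s"
  have h: "h > 0" "h < \<delta>" "h \<le> s" using \<open>\<delta> > 0\<close> \<open>s > 0\<close> by (auto simp: h_def)
  have "F (s - h) z - e * (s - h) \<le> M"
    by (rule M_max) (use h s(1) z in auto)
  with \<delta>[OF h(1,2)] s(2) show False by simp
qed

end

subsection \<open>Long-time decay\<close>

lemma abs_le_exp_of_square_le: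
  fixes r :: real
  assumes "r\<^sup>2 \<le> C * exp (- (2 * K * t))" "C \<ge> 0"
  shows "\<bar>r\<bar> \<le> sqrt C * exp (- (K * t))"
proof -
  have "C * exp (- (2 * K * t)) = (sqrt C * exp (- (K * t)))\<^sup>2"
    using \<open>C \<ge> 0\<close> by (simp add: power_mult_distrib exp_double[symmetric])
  then have "\<bar>r\<bar>\<^sup>2 \<le> (sqrt C * exp (- (K * t)))\<^sup>2"
    using assms(1) by simp
  then show ?thesis by (rule power2_le_imp_le) (use \<open>C \<ge> 0\<close> in simp)
qed

lemma tendsto_exp_neg_mult_at_top: "K > 0 \<Longrightarrow> ((\<lambda>t. c * exp (- (K * t))) \<longlongrightarrow> (0::real)) at_top"
  by (intro tendsto_mult_right_zero filterlim_compose[OF exp_at_bot] filterlim_uminus_at_bot_at_top[THEN filterlim_compose] filterlim_tendsto_pos_mult_at_top[OF tendsto_const] filterlim_ident)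

context unit_measure_heat
begin

text \<open>The gradient estimate with \<open>c = 1\<close>. The threshold for \<open>t\<close>
  makes \<open>exp (2 * K * t)\<close> at least 2, so that subtracting 1 leaves at least half of
  it.\<close>

lemma Gamma_T_le:
  assumes gen: "gen u g" and CD: "CD_infinity b (\<lambda>_. 1) K" and "K > 0"
    and bound: "\<And>x. (l2_apply u x)\<^sup>2 \<le> 1" and t: "ln 2 / (2 * K) \<le> t"
  shows "Gamma (l2_apply (T t u)) (l2_apply (T t u)) x \<le> 2 * K * exp (- (2 * K * t))"
proof -
  let ?E = "exp (2 * K * t)" and ?G = "Gamma (l2_apply (T t u)) (l2_apply (T t u)) x"
  have "ln 2 \<le> 2 * K * t" using t \<open>K > 0\<close> by (simp add: field_simps)
  then have E: "2 \<le> ?E" by (metis exp_ln exp_le_cancel_iff zero_less_numeral)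
  have "0 \<le> ln 2 / (2 * K)" using \<open>K > 0\<close> by simp
  then have "t \<ge> 0" using t by linarith
  from gradient_estimate[OF gen CD \<open>K > 0\<close> bound _ this, of x]
  have "(?E - 1) / K * ?G \<le> 1"
    using zero_le_power2[of "l2_apply (T t u) x"] by linarith
  moreover have "(?E / 2) / K * ?G \<le> (?E - 1) / K * ?G"
    using E \<open>K > 0\<close> by (intro mult_right_mono divide_right_mono) auto
  ultimately have "(?E / 2) / K * ?G \<le> 1" by linarith
  then show ?thesis using \<open>K > 0\<close> by (simp add: exp_minus field_simps)
qed

lemma T_edge_tendsto_zero:
  assumes "gen u g" "CD_infinity b (\<lambda>_. 1) K" "K > 0" "\<And>x. (l2_apply u x)\<^sup>2 \<le> 1" "0 < b x y"
  shows "((\<lambda>t. l2_apply (T t u) y - l2_apply (T t u) x) \<longlongrightarrow> 0) at_top"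
proof (rule Lim_null_comparison)
  let ?C = "4 * K / b x y"
  show "((\<lambda>t. sqrt ?C * exp (- (K * t))) \<longlongrightarrow> 0) at_top"
    by (rule tendsto_exp_neg_mult_at_top[OF \<open>K > 0\<close>])
  show "\<forall>\<^sub>F t in at_top. norm (l2_apply (T t u) y - l2_apply (T t u) x) \<le> sqrt ?C * exp (- (K * t))"
    using eventually_ge_at_top[of "ln 2 / (2 * K)"]
  proof eventually_elim
    case (elim t)
    have "b x y * (l2_apply (T t u) y - l2_apply (T t u) x)\<^sup>2 \<le> 2 * (2 * K * exp (- (2 * K * t)))"
      using edge_le_Gamma[of x y "l2_apply (T t u)"] Gamma_T_le[OF assms(1-4) elim, of x] by linarith
    then have "(l2_apply (T t u) y - l2_apply (T t u) x)\<^sup>2 \<le> ?C * exp (- (2 * K * t))"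
      using \<open>0 < b x y\<close> by (simp add: field_simps)
    from abs_le_exp_of_square_le[OF this] show ?case using assms by simp
  qed
qed

lemma T_diff_tendsto_zero:
  assumes "connected_graph b"
    and "gen u g" "CD_infinity b (\<lambda>_. 1) K" "K > 0" "\<And>x. (l2_apply u x)\<^sup>2 \<le> 1"
  shows "((\<lambda>t. l2_apply (T t u) y - l2_apply (T t u) x) \<longlongrightarrow> 0) at_top"
proof -
  have "(\<lambda>u v. 0 < b u v)\<^sup>*\<^sup>* x y" using assms(1) by (simp add: connected_graph_def)
  then show ?thesis
  proof induction
    case (step y z)
    from tendsto_add[OF step.IH T_edge_tendsto_zero[OF assms(2-5) step.hyps(2)]]
    show ?case by simp
  qed simp
qed

text \<open>Differences between any two vertices vanish in the limit. A value of size
  \<open>e\<close> at \<open>x\<close> would therefore force values of size \<open>e / 2\<close> on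
  arbitrarily large finite sets, against the bounded l2 norm.\<close>

lemma T_tendsto_zero:
  assumes inf: "infinite (UNIV :: 'a set)" and conn: "connected_graph b"
    and gen: "gen u g" and CD: "CD_infinity b (\<lambda>_. 1) K" "K > 0"
    and bound: "\<And>x. (l2_apply u x)\<^sup>2 \<le> 1"
  shows "((\<lambda>t. l2_apply (T t u) x) \<longlongrightarrow> 0) at_top"
proof (rule tendstoI)
  fix e :: real assume "e > 0"
  \<comment> \<open>That many values of size \<open>e / 2\<close> already exceed the squared norm of
    \<open>u\<close>, which bounds that of \<open>T t u\<close>.\<close>
  obtain n where n: "(norm u)\<^sup>2 / (e / 2)\<^sup>2 < real n" using reals_Archimedean2 by blast
  obtain B :: "'a set" where B: "finite B" "card B = n"
    using infinite_arbitrarily_large[OF inf] by blast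
  have "\<forall>\<^sub>F t in at_top. \<bar>l2_apply (T t u) y - l2_apply (T t u) x\<bar> < e / 2" for y
    using tendstoD[OF T_diff_tendsto_zero[OF conn gen CD bound], of "e / 2" y x] \<open>e > 0\<close>
    by (simp add: dist_real_def)
  then have "\<forall>\<^sub>F t in at_top. \<forall>y\<in>B. \<bar>l2_apply (T t u) y - l2_apply (T t u) x\<bar> < e / 2"
    using B(1) by (simp add: eventually_ball_finite)
  with eventually_ge_at_top[of 0] show "\<forall>\<^sub>F t in at_top. dist (l2_apply (T t u) x) 0 < e"
  proof eventually_elim
    case (elim t)
    show ?case
    proof (rule ccontr)
      assume "\<not> ?case"
      then have ge: "e \<le> \<bar>l2_apply (T t u) x\<bar>" by simp
      have "(e / 2)\<^sup>2 \<le> (l2_apply (T t u) y)\<^sup>2" if "y \<in> B" for y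
      proof -
        have "e / 2 \<le> \<bar>l2_apply (T t u) y\<bar>" using bspec[OF elim(2) that] ge by linarith
        then show ?thesis using power_mono[of "e / 2" "\<bar>l2_apply (T t u) y\<bar>" 2] \<open>e > 0\<close> by simp
      qed
      then have "real n * (e / 2)\<^sup>2 \<le> (\<Sum>y\<in>B. (l2_apply (T t u) y)\<^sup>2)"
        using sum_mono[of B "\<lambda>_. (e / 2)\<^sup>2"] B by simp
      also have "\<dots> \<le> (norm (T t u))\<^sup>2" by (rule sum_square_le_norm_l2[OF B(1)])
      also have "\<dots> \<le> (norm u)\<^sup>2"
        using norm_T_le[OF gen elim(1)] by (simp add: power_mono)
      finally show False using n \<open>e > 0\<close> by (simp add: divide_less_eq)
    qed
  qed
qed

text \<open>The time derivative decays like \<open>exp (- (K * s))\<close> and the limit is 0, so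
  the value at \<open>t\<close> is controlled by what remains to be lost. The constant depends on
  \<open>x\<close> and \<open>K\<close> but not on \<open>u\<close>, which the final contradiction
  relies on.\<close>

lemma T_le_exp:
  assumes inf: "infinite (UNIV :: 'a set)" and conn: "connected_graph b"
    and gen: "gen u g" and CD: "CD_infinity b (\<lambda>_. 1) K" "K > 0"
    and bound: "\<And>x. (l2_apply u x)\<^sup>2 \<le> 1" and t: "ln 2 / (2 * K) \<le> t"
  shows "l2_apply (T t u) x \<le> sqrt (4 * K * (\<Sum>y\<in>nbrs x. b x y)) / K * exp (- (K * t))"
proof -
  \<comment> \<open>The factor 2 of \<open>lap_square_le_Gamma\<close> times the factor
    \<open>2 * K\<close> of \<open>Gamma_T_le\<close>.\<close>
  define C where "C = 4 * K * (\<Sum>y\<in>nbrs x. b x y)"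
  have "C \<ge> 0" using \<open>K > 0\<close> by (auto simp: C_def sum_nonneg)
  \<comment> \<open>The added exponential has derivative \<open>sqrt C * exp (- (K * s))\<close>,
    which dominates that of the flow. So \<open>\<psi>\<close> is nondecreasing from
    \<open>t\<close> on with limit 0, hence nonpositive at \<open>t\<close>.\<close>
  define \<psi> where "\<psi> s = l2_apply (T s u) x - sqrt C / K * exp (- (K * s))" for s
  have "0 < ln 2 / (2 * K)" using \<open>K > 0\<close> by simp
  then have t0: "t > 0" using t by linarith
  have le: "\<psi> t \<le> \<psi> r" if "t \<le> r" for r
  proof (rule DERIV_nonneg_imp_nondecreasing[OF that])
    fix s assume s: "t \<le> s" "s \<le> r"
    have lap: "lap (l2_apply (T s u)) = l2_apply (T s g)"
      using gen_lap[OF gen_T[OF gen, of s]] s t0 by simp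
    have "(lap (l2_apply (T s u)) x)\<^sup>2
        \<le> 2 * (\<Sum>y\<in>nbrs x. b x y) * Gamma (l2_apply (T s u)) (l2_apply (T s u)) x"
      by (rule lap_square_le_Gamma)
    also have "\<dots> \<le> 2 * (\<Sum>y\<in>nbrs x. b x y) * (2 * K * exp (- (2 * K * s)))"
      using Gamma_T_le[OF gen CD bound, of s x] s t by (intro mult_left_mono) (auto simp: sum_nonneg)
    also have "\<dots> = C * exp (- (2 * K * s))" by (simp add: C_def)
    finally have "\<bar>l2_apply (T s g) x\<bar> \<le> sqrt C * exp (- (K * s))"
      unfolding lap by (rule abs_le_exp_of_square_le[OF _ \<open>C \<ge> 0\<close>])
    moreover have "(\<psi> has_real_derivative l2_apply (T s g) x + sqrt C * exp (- (K * s))) (at s)"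
      unfolding \<psi>_def[abs_def] using s t0 \<open>K > 0\<close>
      by (auto intro!: derivative_eq_intros DERIV_T_apply[OF gen])
    ultimately show "\<exists>y. (\<psi> has_real_derivative y) (at s) \<and> 0 \<le> y"
      by (intro exI conjI) auto
  qed
  have "(\<psi> \<longlongrightarrow> 0 - 0) at_top"
    unfolding \<psi>_def[abs_def]
    by (intro tendsto_diff T_tendsto_zero[OF inf conn gen CD bound] tendsto_exp_neg_mult_at_top CD)
  then have "\<psi> t \<le> 0 - 0"
    by (rule tendsto_lowerbound) (auto intro!: eventually_mono[OF eventually_ge_at_top[of t]] le)
  then show ?thesis by (simp add: \<psi>_def C_def)
qed

end

subsection \<open>Finiteness\<close>

text \<open>Transfers the semigroup from functions to the Hilbert space type. \<open>P t\<close>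
  preserves square-summability for \<open>t \<ge> 0\<close>, which is where \<open>Abs_l2\<close> is
  meaningful.\<close>

lemma heat_semigroup_l2:
  assumes "locally_finite_graph b (\<lambda>_. 1)" and heat: "heat_semigroup b (\<lambda>_. 1) P"
  defines "T \<equiv> \<lambda>t u. Abs_l2 (P t (l2_apply u))"
  shows "unit_measure_heat b T" and "\<And>t u. t \<ge> 0 \<Longrightarrow> l2_apply (T t u) = P t (l2_apply u)"
proof -
  have P: "C0_semigroup (\<lambda>_. 1) P"
    and P_gen: "\<And>u h. generator (\<lambda>_. 1) P u (\<lambda>x. - h x) \<longleftrightarrow> friedrichs b (\<lambda>_. 1) u h"
    using heat by (auto simp: heat_semigroup_def)
  note P_simps = P[unfolded C0_semigroup_def]
  have P_lin: "P t (\<lambda>x. \<alpha> * l2_apply u x + \<beta> * l2_apply v x)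
      = (\<lambda>x. \<alpha> * P t (l2_apply u) x + \<beta> * P t (l2_apply v) x)" if "t \<ge> 0" for t \<alpha> \<beta> u v
    using conjunct1[OF conjunct2[OF P_simps]] that by simp
  have P_bdd: "\<exists>C. \<forall>f\<in>ell2 (\<lambda>_. 1). ell2_norm (\<lambda>_. 1) (P t f) \<le> C * ell2_norm (\<lambda>_. 1) f" if "t \<ge> 0" for t
    using conjunct1[OF conjunct2[OF conjunct2[OF P_simps]]] that by simp
  show T: "l2_apply (T t u) = P t (l2_apply u)" if "t \<ge> 0" for t u
  proof -
    have "P t (l2_apply u) \<in> ell2 (\<lambda>_. 1)"
      using P that l2_apply_in_ell2[of u] unfolding C0_semigroup_def by blast
    then show ?thesis unfolding T_def ell2_one_iff by (auto simp: l2_apply_inverse)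
  qed
  interpret c0_semigroup T
  proof (rule c0_semigroup.intro)
    fix s t :: real and u :: "'a l2"
    show "bounded_linear (T t)" if t: "0 \<le> t"
    proof -
      obtain C where C: "\<And>f. f \<in> ell2 (\<lambda>_. 1) \<Longrightarrow> ell2_norm (\<lambda>_. 1) (P t f) \<le> C * ell2_norm (\<lambda>_. 1) f"
        using P_bdd[OF t] by blast
      have lincomb: "T t (\<alpha> *\<^sub>R u + \<beta> *\<^sub>R v) = \<alpha> *\<^sub>R T t u + \<beta> *\<^sub>R T t v" for \<alpha> \<beta> u v
        using P_lin[OF t, of \<alpha> u \<beta> v]
        by (intro l2_eqI) (simp add: T[OF t] plus_l2.rep_eq[abs_def] scaleR_l2.rep_eq[abs_def])
      show ?thesis
      proof (rule bounded_linear_intro[where K = C])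
        show "T t (u + v) = T t u + T t v" for u v using lincomb[of 1 u 1 v] by simp
        show "T t (r *\<^sub>R u) = r *\<^sub>R T t u" for r u using lincomb[of r u 0 u] by simp
        show "norm (T t u) \<le> norm u * C" for u
          using C[of "l2_apply u"] by (simp add: ell2_norm_l2 flip: T[OF t]) (simp add: mult.commute)
      qed
    qed
    show "T 0 u = u"
      using P by (simp add: T_def C0_semigroup_def l2_apply_inverse)
    show "T (s + t) u = T s (T t u)" if "0 \<le> s" "0 \<le> t"
      using P that by (intro l2_eqI) (simp add: T C0_semigroup_def)
    have "((\<lambda>t. ell2_norm (\<lambda>_. 1) (\<lambda>x. P t (l2_apply u) x - l2_apply u x)) \<longlongrightarrow> 0) (at_right 0)"
      using P by (simp add: C0_semigroup_def)
    moreover have "\<forall>\<^sub>F t in at_right 0. ell2_norm (\<lambda>_. 1) (\<lambda>x. P t (l2_apply u) x - l2_apply u x) = norm (T t u - u)"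
      using eventually_at_right_less
    proof eventually_elim
      case (elim t)
      have "(\<lambda>x. P t (l2_apply u) x - l2_apply u x) = l2_apply (T t u - u)" using elim by (auto simp: T)
      then show ?case by (simp only: ell2_norm_l2)
    qed
    ultimately have "((\<lambda>t. norm (T t u - u)) \<longlongrightarrow> 0) (at_right 0)"
      by (rule Lim_transform_eventually)
    then show "((\<lambda>t. T t u) \<longlongrightarrow> u) (at_right 0)"
      by (simp add: tendsto_iff dist_norm)
  qed
  have "gen u g \<longleftrightarrow> generator (\<lambda>_. 1) P (l2_apply u) (l2_apply g)" for u g
  proof -
    have "\<forall>\<^sub>F t in at_right 0. ell2_norm (\<lambda>_. 1) (\<lambda>x. (P t (l2_apply u) x - l2_apply u x) / t - l2_apply g x)
        = norm ((T t u - u) /\<^sub>R t - g)"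
      using eventually_at_right_less
    proof eventually_elim
      case (elim t)
      have "(\<lambda>x. (P t (l2_apply u) x - l2_apply u x) / t - l2_apply g x) = l2_apply ((T t u - u) /\<^sub>R t - g)"
        using elim by (auto simp: T divide_inverse mult.commute)
      then show ?case by (simp only: ell2_norm_l2)
    qed
    then have "((\<lambda>t. ell2_norm (\<lambda>_. 1) (\<lambda>x. (P t (l2_apply u) x - l2_apply u x) / t - l2_apply g x)) \<longlongrightarrow> 0) (at_right 0)
        \<longleftrightarrow> ((\<lambda>t. norm ((T t u - u) /\<^sub>R t - g)) \<longlongrightarrow> 0) (at_right 0)"
      by (rule tendsto_cong)
    then show ?thesis
      by (simp add: gen_def generator_def tendsto_iff dist_norm)
  qed
  then have "gen u g \<longleftrightarrow> friedrichs b (\<lambda>_. 1) (l2_apply u) (\<lambda>x. - l2_apply g x)" for u g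
    using P_gen[of "l2_apply u" "\<lambda>x. - l2_apply g x"] by simp
  then show "unit_measure_heat b T"
    by unfold_locales (use assms(1) in auto)
qed

theorem corollary6p3:
  fixes b :: "'a::countable \<Rightarrow> 'a \<Rightarrow> real" and m :: "'a \<Rightarrow> real" and K :: real
  assumes "locally_finite_graph b m"
    and "connected_graph b"
    and "\<forall>x y. b x y \<in> {0, 1}"
    and "\<forall>x. m x = 1"
    and "K > 0"
    and "CD_infinity b m K"
    and "stochastically_complete b m"
  shows "finite (UNIV :: 'a set)"
proof (rule ccontr)
  assume inf: "infinite (UNIV :: 'a set)"
  have m: "m = (\<lambda>_. 1)" using assms(4) by auto
  note graph = assms(1)[unfolded m] and CD = assms(6)[unfolded m]
  obtain P where heat: "heat_semigroup b (\<lambda>_. 1) P"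
    and P1: "\<And>t. t \<ge> 0 \<Longrightarrow> heat_extension (\<lambda>_. 1) P t (\<lambda>_. 1) = (\<lambda>_. 1)"
    using assms(7) unfolding m stochastically_complete_def by blast
  define T where "T = (\<lambda>t u. Abs_l2 (P t (l2_apply u)))"
  interpret unit_measure_heat b T
    unfolding T_def by (rule heat_semigroup_l2(1)[OF graph heat])
  have T: "l2_apply (T t u) = P t (l2_apply u)" if "t \<ge> 0" for t u
    unfolding T_def by (rule heat_semigroup_l2(2)[OF graph heat that])
  fix x :: 'a
  let ?D = "sqrt (4 * K * (\<Sum>y\<in>nbrs x. b x y)) / K"
  \<comment> \<open>Since \<open>?D\<close> does not involve the initial function, \<open>t\<close>
    can be fixed before the finite set \<open>A\<close>, which is chosen in terms of
    \<open>t\<close>.\<close>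
  have "\<forall>\<^sub>F t in at_top. ?D * exp (- (K * t)) < 1 / 2"
    using order_tendstoD(2)[OF tendsto_exp_neg_mult_at_top[OF \<open>K > 0\<close>], of "1 / 2" ?D] by simp
  then have "\<forall>\<^sub>F t in at_top. ?D * exp (- (K * t)) < 1 / 2 \<and> ln 2 / (2 * K) \<le> t \<and> 0 \<le> t"
    by (intro eventually_conj eventually_ge_at_top)
  then obtain t where t: "?D * exp (- (K * t)) < 1 / 2" "ln 2 / (2 * K) \<le> t" "0 \<le> t"
    using eventually_happens[of _ "at_top :: real filter"] by auto
  have ind: "l2_apply (Abs_l2 (indicator A)) = indicator A" if "finite A" for A :: "'a set"
    using that by (intro fin_supp_l2 fin_supp_indicator)
  have sum_1: "(\<Sum>\<^sub>\<infinity>y. P t (indicator {y}) x) = 1"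
    using fun_cong[OF P1[OF t(3)], of x] by (simp add: heat_extension_def heat_kernel_def)
  \<comment> \<open>A family that is not summable has \<open>infsum\<close> equal to 0 by default,
    so the value 1 forces summability.\<close>
  then have "(\<lambda>y. P t (indicator {y}) x) summable_on UNIV"
    using infsum_not_exists[of "\<lambda>y. P t (indicator {y}) x" UNIV] by fastforce
  \<comment> \<open>By linearity the flow started at the indicator of this \<open>A\<close> is at
    least \<open>1 / 2\<close> at \<open>x\<close> and time \<open>t\<close>, while the decay bound
    keeps it below \<open>1 / 2\<close>.\<close>
  then obtain A where A: "finite A" "dist (\<Sum>y\<in>A. P t (indicator {y}) x) 1 \<le> 1 / 2"
    using infsum_finite_approximation[of "\<lambda>y. P t (indicator {y}) x" UNIV "1 / 2"] sum_1 by auto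
  have "Abs_l2 (indicator A) = (\<Sum>y\<in>A. Abs_l2 (indicator {y}))"
  proof (rule l2_eqI)
    fix z
    have "l2_apply (\<Sum>y\<in>A. Abs_l2 (indicator {y})) z = (\<Sum>y\<in>A. indicator {y} z)"
      by (simp add: linear_sum[OF bounded_linear.linear[OF bounded_linear_l2_apply]] ind)
    also have "\<dots> = indicator A z"
      using A(1) by (simp add: indicator_def sum.delta if_distrib cong: if_cong)
    finally show "l2_apply (Abs_l2 (indicator A)) z = l2_apply (\<Sum>y\<in>A. Abs_l2 (indicator {y})) z"
      using A(1) by (simp add: ind)
  qed
  then have "T t (Abs_l2 (indicator A)) = (\<Sum>y\<in>A. T t (Abs_l2 (indicator {y})))"
    using linear_sum[OF bounded_linear.linear[OF bounded_linear_T[OF t(3)]], of "\<lambda>y. Abs_l2 (indicator {y})" A]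
    by simp
  then have "l2_apply (T t (Abs_l2 (indicator A))) x = (\<Sum>y\<in>A. l2_apply (T t (Abs_l2 (indicator {y}))) x)"
    by (simp add: linear_sum[OF bounded_linear.linear[OF bounded_linear_l2_apply]])
  also have "\<dots> = (\<Sum>y\<in>A. P t (indicator {y}) x)"
    by (simp add: T[OF t(3)] ind)
  finally have "l2_apply (T t (Abs_l2 (indicator A))) x \<ge> 1 / 2"
    using A(2) unfolding dist_real_def by linarith
  moreover have "l2_apply (T t (Abs_l2 (indicator A))) x \<le> ?D * exp (- (K * t))"
    using A(1) by (intro T_le_exp[OF inf assms(2) gen_fin_supp CD \<open>K > 0\<close> _ t(2)])
      (auto simp: ind fin_supp_indicator indicator_def)
  ultimately show False using t(1) by simp
qed

end
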